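(* Let $\gamma_1,\gamma_2$ be the instantaneous SNRs of the RF and optical hops described in the context, let $\kappa\ge1$, and let $$\gamma=\frac{\gamma_1\gamma_2}{\kappa\gamma_2+C},\qquad C=\mathbb{E}[\gamma_1]+\kappa,$$ be the end-to-end signal-to-noise-plus-distortion ratio of amplify-and-forward relaying with an ideal source and relays impaired by a non-linear high power amplifier. Let $\varpi=1$ if $r=1$ (heterodyne detection) and $\varpi=\frac{e}{2\pi}$ if $r=2$ (IM/DD). Then the ergodic capacity $\overline{C}=\mathbb{E}[\log_2(1+\varpi\gamma)]$ equals $$\overline{C}=\frac{m\xi^2A\,\varpi\mu_1}{2^r(2\pi)^{r-1}\ln 2}\binom{M}{m}\sum_{k=0}^{m-1}\sum_{n=1}^{\beta}\binom{m-1}{k}\frac{(-1)^kb_n\,r^{\alpha+n-1}}{(M-m+k+1)\zeta_3}\;\mathcal{H}_n\left(\frac{\varpi\mu_1}{\zeta_3},\frac{\zeta_4}{\zeta_3\mu_r}\right),$$ where $$\zeta_3=\frac{(M-m+k+1)\kappa}{(M-m+k)(1-\rho_m)+1},\qquad \zeta_4=\frac{(M-m+k+1)\,C}{(M-m+k)(1-\rho_m)+1}\left(\frac{B}{r^2}\right)^r$$ (both depending on $k$), and $\mathcal{H}_n$ is the bivariate Fox H-function $$\mathcal{H}_n(x,y)=H_{1,0:1,1;r,3r+1}^{0,1:1,1;3r+1,0}\left(\begin{matrix}(0;1,1)\\ -\end{matrix}\;\middle|\;\begin{matrix}(0,1)\\(0,1)\end{matrix}\;\middle|\;\begin{matrix}(\tau_5,[1]_r)\\(\tau_4,[1]_{3r+1})\end{matrix}\;\middle|\;x,y\right)$$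 with $\tau_5=\Delta(r:\xi^2+1)$ and $\tau_4=[\Delta(r:\xi^2),\Delta(r:\alpha),\Delta(r:n),0]$.
   Context: Notation. $\Delta(j:x)$ denotes the list $\frac{x}{j},\frac{x+1}{j},\dots,\frac{x+j-1}{j}$; $[x]_j$ is the vector of $j$ entries equal to $x$; $\tau_{5,j}$, $\tau_{4,j}$ denote the $j$-th entries of $\tau_5$ ($r$ entries) and $\tau_4$ ($3r+1$ entries). Explicitly, the bivariate Fox H-function used in the claim is the double Mellin–Barnes integral, for $x,y>0$, $$\mathcal{H}_n(x,y)=\frac{1}{(2\pi i)^2}\int_{L_1}\int_{L_2}\Gamma(1+s+t)\,\Gamma(-s)\Gamma(1+s)\,\frac{\prod_{j=1}^{3r+1}\Gamma(\tau_{4,j}-t)}{\prod_{j=1}^{r}\Gamma(\tau_{5,j}-t)}\,x^{s}y^{t}\,dt\,ds,$$ where $L_1,L_2$ are upward vertical lines separating the poles of the Gamma factors with $+s$ or $+t$ from those with $-s$ or $-t$ (i.e. $-1<\mathrm{Re}\,s<0$, $\mathrm{Re}\,t<0$, $\mathrm{Re}(s+t)>-1$). $G_{p,q}^{m,n}\left(z\,\middle|\,\begin{matrix}a_1,\dots,a_p\\ b_1,\dots,b_q\end{matrix}\right)$ is the Meijer G-function with the standard convention $\frac{1}{2\pi i}\int \frac{\prod_{j=1}^m\Gamma(b_j+s)\prod_{j=1}^n\Gamma(1-a_j-s)}{\prod_{j=m+1}^q\Gamma(1-b_j-s)\prod_{j=n+1}^p\Gamma(a_j+s)}z^{-s}ds$,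 the contour separating the poles of the $\Gamma(b_j+s)$ from those of the $\Gamma(1-a_j-s)$. Amplifier parameter. In the paper $\kappa=1+\frac{\sigma_\tau^2}{\varepsilon^2G^2\sigma_0^2}$, where $\varepsilon$ and $\sigma_\tau^2$ are the amplifier's scale and distortion-noise variance, $G$ the relay gain and $\sigma_0^2$ the noise variance; only the constant $\kappa\ge1$ enters the claim. RF hop. $M\ge1$ is the number of relays, $1\le m\le M$ the rank of the selected relay, $\rho_m\in[0,1]$ the time correlation coefficient between outdated and actual CSI, $\mu_1>0$ the average SNR of the first hop. $\gamma_1$ is a nonnegative random variable with density, for $x\ge0$, $$f_{\gamma_1}(x)=m\binom{M}{m}\sum_{k=0}^{m-1}\frac{(-1)^k\binom{m-1}{k}}{[(M-m+k)(1-\rho_m)+1]\mu_1}\exp\left(-\frac{(M-m+k+1)x}{[(M-m+k)(1-\rho_m)+1]\mu_1}\right),$$ so that $\mathbb{E}[\gamma_1]=m\binom{M}{m}\sum_{k=0}^{m-1}\binom{m-1}{k}(-1)^k\frac{[(M-m+k)(1-\rho_m)+1]\mu_1}{(M-m+k+1)^2}$. Optical hop. $r\in\{1,2\}$ is the detection type, $\mu_r>0$ the average electrical SNR, $\xi>0$ the pointing error coefficient, $\alpha>0$, $\beta$ a positive integer, $g>0$, $\Omega'>0$ the Málaga turbulence parameters, $B>0$ a constant of the fading law. Put $$A=\frac{2\alpha^{\alpha/2}}{g^{1+\alpha/2}\Gamma(\alpha)}\left(\frac{g\beta}{g\beta+\Omega'}\right)^{\beta+\alpha/2},\quad a_n=\binom{\beta-1}{n-1}\frac{(g\beta+\Omega')^{1-n/2}}{(n-1)!}\left(\frac{\Omega'}{g}\right)^{n-1}\left(\frac{\alpha}{\beta}\right)^{n/2},\quad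 b_n=a_n\left(\frac{g\beta+\Omega'}{\alpha\beta}\right)^{\frac{\alpha+n}{2}}.$$ $\gamma_2$ is a positive random variable, independent of $\gamma_1$, with density for $x>0$ $$f_{\gamma_2}(x)=\frac{\xi^2A}{2^r x}\sum_{n=1}^{\beta}b_n\,G_{1,3}^{3,0}\left(B\left(\frac{x}{\mu_r}\right)^{1/r}\;\middle|\;\begin{matrix}\xi^2+1\\ \xi^2,\ \alpha,\ n\end{matrix}\right).$$ *)

theory Defs
  imports "HOL-Probability.Probability"
begin

text \<open>
  Integral over the upward vertical line with real part \<open>c\<close>, parametrised by \<open>s = c + iu\<close>.
  It is a Lebesgue integral, so it is meaningful for absolutely convergent integrands, as are all
  Mellin--Barnes integrals used here.
\<close>

definition vline_integral :: "real \<Rightarrow> (complex \<Rightarrow> complex) \<Rightarrow> complex" where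
  "vline_integral c f = (\<integral>u. f (Complex c u) * \<i> \<partial>lborel)"


subsection \<open>Meijer G-function\<close>

text \<open>
  In the kernels below a pole of a Gamma factor in a denominator is harmless: \<open>Gamma\<close> is \<open>0\<close> there
  by convention and \<open>x / 0 = 0\<close>, which is the value of the entire function \<open>1 / Gamma\<close>.
  The orders \<open>p\<close> and \<open>q\<close> are the lengths of the parameter lists.
\<close>

definition meijer_G_kernel ::
  "nat \<Rightarrow> nat \<Rightarrow> complex list \<Rightarrow> complex list \<Rightarrow> complex \<Rightarrow> complex" where
  "meijer_G_kernel m n as bs s =
     ((\<Prod>b\<leftarrow>take m bs. Gamma (b + s)) * (\<Prod>a\<leftarrow>take n as. Gamma (1 - a - s))) /
     ((\<Prod>b\<leftarrow>drop m bs. Gamma (1 - b - s)) * (\<Prod>a\<leftarrow>drop n as. Gamma (a + s)))"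

text \<open>
  A vertical line has the poles of \<open>Gamma (b + s)\<close> on its left and those of \<open>Gamma (1 - a - s)\<close> on
  its right iff the arguments of these factors have positive real part on it.
\<close>

definition meijer_G_line :: "nat \<Rightarrow> nat \<Rightarrow> complex list \<Rightarrow> complex list \<Rightarrow> real \<Rightarrow> bool" where
  "meijer_G_line m n as bs c \<longleftrightarrow>
     (\<forall>b\<in>set (take m bs). 0 < Re b + c) \<and> (\<forall>a\<in>set (take n as). 0 < 1 - Re a - c)"

text \<open>
  The contour is any separating vertical line, the value of the integral being independent of which
  one is taken.  (Parameters whose poles can only be separated by an indented contour are not needed
  and not covered.)
\<close>

definition meijer_G ::
  "nat \<Rightarrow> nat \<Rightarrow> complex list \<Rightarrow> complex list \<Rightarrow> real \<Rightarrow> complex" where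
  "meijer_G m n as bs z =
     1 / (2 * of_real pi * \<i>) *
     vline_integral (SOME c. meijer_G_line m n as bs c)
       (\<lambda>s. meijer_G_kernel m n as bs s * of_real z powr (- s))"


subsection \<open>Bivariate Fox H-function\<close>

text \<open>
  The function
  \<open>H^{0,n1 : m2,n2 ; m3,n3}_{p1,q1 : p2,q2 ; p3,q3}\<close> with parameters \<open>(a; \<alpha>, A)\<close> in \<open>as\<close>,
  \<open>(b; \<beta>, B)\<close> in \<open>bs\<close>, then \<open>(c, \<gamma>)\<close> in \<open>cs\<close>, \<open>(d, \<delta>)\<close> in \<open>ds\<close> for the first variable and
  \<open>es\<close>, \<open>fs\<close> for the second one.
\<close>

definition fox_H_kernel ::
  "nat \<Rightarrow> nat \<Rightarrow> (complex \<times> real) list \<Rightarrow> (complex \<times> real) list \<Rightarrow> complex \<Rightarrow> complex" where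
  "fox_H_kernel m n cs ds s =
     ((\<Prod>(d, \<delta>)\<leftarrow>take m ds. Gamma (d - of_real \<delta> * s)) *
      (\<Prod>(c, \<gamma>)\<leftarrow>take n cs. Gamma (1 - c + of_real \<gamma> * s))) /
     ((\<Prod>(d, \<delta>)\<leftarrow>drop m ds. Gamma (1 - d + of_real \<delta> * s)) *
      (\<Prod>(c, \<gamma>)\<leftarrow>drop n cs. Gamma (c - of_real \<gamma> * s)))"

definition fox_H2_joint_kernel ::
  "nat \<Rightarrow> (complex \<times> real \<times> real) list \<Rightarrow> (complex \<times> real \<times> real) list \<Rightarrow>
   complex \<Rightarrow> complex \<Rightarrow> complex" where
  "fox_H2_joint_kernel n as bs s t =
     (\<Prod>(a, \<alpha>, A)\<leftarrow>take n as. Gamma (1 - a + of_real \<alpha> * s + of_real A * t)) /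
     ((\<Prod>(a, \<alpha>, A)\<leftarrow>drop n as. Gamma (a - of_real \<alpha> * s - of_real A * t)) *
      (\<Prod>(b, \<beta>, B)\<leftarrow>bs. Gamma (1 - b + of_real \<beta> * s + of_real B * t)))"

definition fox_H_line ::
  "nat \<Rightarrow> nat \<Rightarrow> (complex \<times> real) list \<Rightarrow> (complex \<times> real) list \<Rightarrow> real \<Rightarrow> bool" where
  "fox_H_line m n cs ds x \<longleftrightarrow>
     (\<forall>(d, \<delta>)\<in>set (take m ds). 0 < Re d - \<delta> * x) \<and>
     (\<forall>(c, \<gamma>)\<in>set (take n cs). 0 < 1 - Re c + \<gamma> * x)"

definition fox_H2_lines ::
  "nat \<Rightarrow> nat \<Rightarrow> nat \<Rightarrow> nat \<Rightarrow> nat \<Rightarrow>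
   (complex \<times> real \<times> real) list \<Rightarrow> (complex \<times> real) list \<Rightarrow> (complex \<times> real) list \<Rightarrow>
   (complex \<times> real) list \<Rightarrow> (complex \<times> real) list \<Rightarrow> real \<Rightarrow> real \<Rightarrow> bool" where
  "fox_H2_lines n1 m2 n2 m3 n3 as cs ds es fs \<sigma> \<tau> \<longleftrightarrow>
     (\<forall>(a, \<alpha>, A)\<in>set (take n1 as). 0 < 1 - Re a + \<alpha> * \<sigma> + A * \<tau>) \<and>
     fox_H_line m2 n2 cs ds \<sigma> \<and> fox_H_line m3 n3 es fs \<tau>"

definition fox_H2 ::
  "nat \<Rightarrow> nat \<Rightarrow> nat \<Rightarrow> nat \<Rightarrow> nat \<Rightarrow>
   (complex \<times> real \<times> real) list \<Rightarrow> (complex \<times> real \<times> real) list \<Rightarrow>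
   (complex \<times> real) list \<Rightarrow> (complex \<times> real) list \<Rightarrow>
   (complex \<times> real) list \<Rightarrow> (complex \<times> real) list \<Rightarrow> real \<Rightarrow> real \<Rightarrow> complex" where
  "fox_H2 n1 m2 n2 m3 n3 as bs cs ds es fs x y =
     (let (\<sigma>, \<tau>) = (SOME (\<sigma>, \<tau>). fox_H2_lines n1 m2 n2 m3 n3 as cs ds es fs \<sigma> \<tau>) in
      1 / (2 * of_real pi * \<i>)\<^sup>2 *
      vline_integral \<sigma> (\<lambda>s. vline_integral \<tau> (\<lambda>t.
        fox_H2_joint_kernel n1 as bs s t * fox_H_kernel m2 n2 cs ds s * fox_H_kernel m3 n3 es fs t *
        of_real x powr s * of_real y powr t)))"


subsection \<open>The function \<open>H\<^sub>n\<close> of the capacity formula\<close>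

definition Delta :: "nat \<Rightarrow> real \<Rightarrow> real list" where
  "Delta j x = map (\<lambda>i. (x + real i) / real j) [0..<j]"

definition tau5 :: "nat \<Rightarrow> real \<Rightarrow> real list" where
  "tau5 r \<xi> = Delta r (\<xi>\<^sup>2 + 1)"

definition tau4 :: "nat \<Rightarrow> real \<Rightarrow> real \<Rightarrow> nat \<Rightarrow> real list" where
  "tau4 r \<xi> \<alpha> n = Delta r (\<xi>\<^sup>2) @ Delta r \<alpha> @ Delta r (real n) @ [0]"

definition capacity_H :: "nat \<Rightarrow> real \<Rightarrow> real \<Rightarrow> nat \<Rightarrow> real \<Rightarrow> real \<Rightarrow> complex" where
  "capacity_H r \<xi> \<alpha> n x y =
     fox_H2 1 1 1 (3 * r + 1) 0
       [(0, 1, 1)] []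
       [(0, 1)] [(0, 1)]
       (map (\<lambda>a. (of_real a, 1)) (tau5 r \<xi>)) (map (\<lambda>a. (of_real a, 1)) (tau4 r \<xi> \<alpha> n))
       x y"

lemma length_tau5 [simp]: "length (tau5 r \<xi>) = r"
  by (simp add: tau5_def Delta_def)

lemma length_tau4 [simp]: "length (tau4 r \<xi> \<alpha> n) = 3 * r + 1"
  by (simp add: tau4_def Delta_def)

lemma capacity_H_lines:
  assumes "0 < \<xi>" "0 < \<alpha>"
  shows "fox_H2_lines 1 1 1 (3 * r + 1) 0 [(0, 1, 1)] [(0, 1)] [(0, 1)]
           (map (\<lambda>a. (of_real a, 1)) (tau5 r \<xi>)) (map (\<lambda>a. (of_real a, 1)) (tau4 r \<xi> \<alpha> n)) \<sigma> \<tau>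
         \<longleftrightarrow> - 1 < \<sigma> \<and> \<sigma> < 0 \<and> \<tau> < 0 \<and> - 1 < \<sigma> + \<tau>"
proof -
  have "\<tau> < (x + real i) / real r" if "\<tau> < 0" "0 \<le> x" for x i
    using that by (meson divide_nonneg_nonneg add_nonneg_nonneg of_nat_0_le_iff less_le_trans)
  then have "(\<forall>a\<in>set (tau4 r \<xi> \<alpha> n). \<tau> < a) \<longleftrightarrow> \<tau> < 0"
    using assms by (auto simp: tau4_def Delta_def)
  then show ?thesis
    by (auto simp: fox_H2_lines_def fox_H_line_def)
qed

lemma capacity_H_eq:
  assumes "0 < \<xi>" "0 < \<alpha>"
  obtains \<sigma> \<tau> where "- 1 < \<sigma>" "\<sigma> < 0" "\<tau> < 0" "- 1 < \<sigma> + \<tau>"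
    "\<And>x y. capacity_H r \<xi> \<alpha> n x y =
       1 / (2 * of_real pi * \<i>)\<^sup>2 *
       vline_integral \<sigma> (\<lambda>s. vline_integral \<tau> (\<lambda>t.
         Gamma (1 + s + t) * (Gamma (- s) * Gamma (1 + s)) *
         ((\<Prod>a\<leftarrow>tau4 r \<xi> \<alpha> n. Gamma (of_real a - t)) / (\<Prod>a\<leftarrow>tau5 r \<xi>. Gamma (of_real a - t))) *
         of_real x powr s * of_real y powr t))"
proof -
  define L where "L = (\<lambda>(\<sigma>, \<tau>). fox_H2_lines 1 1 1 (3 * r + 1) 0 [(0, 1, 1)] [(0, 1)] [(0, 1)]
           (map (\<lambda>a. (of_real a, 1)) (tau5 r \<xi>)) (map (\<lambda>a. (of_real a, 1)) (tau4 r \<xi> \<alpha> n)) \<sigma> \<tau>)"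
  obtain \<sigma> \<tau> where st: "(SOME p. L p) = (\<sigma>, \<tau>)"
    by fastforce
  have "L (- 1 / 4, - 1 / 4)"
    unfolding L_def prod.case capacity_H_lines[OF assms] by simp
  then have "L (\<sigma>, \<tau>)"
    using st by (metis someI)
  then have "- 1 < \<sigma> \<and> \<sigma> < 0 \<and> \<tau> < 0 \<and> - 1 < \<sigma> + \<tau>"
    unfolding L_def prod.case capacity_H_lines[OF assms] .
  moreover have "take (Suc (3 * r)) (tau4 r \<xi> \<alpha> n) = tau4 r \<xi> \<alpha> n"
    "drop (Suc (3 * r)) (tau4 r \<xi> \<alpha> n) = []"
    by simp_all
  ultimately show ?thesis
    using st unfolding L_def
    by (intro that[of \<sigma> \<tau>])
       (simp_all add: capacity_H_def fox_H2_def fox_H2_joint_kernel_def fox_H_kernel_def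
         take_map drop_map comp_def)
qed


subsection \<open>The two hops\<close>

definition has_pdf :: "'a measure \<Rightarrow> ('a \<Rightarrow> real) \<Rightarrow> (real \<Rightarrow> real) \<Rightarrow> bool" where
  "has_pdf P X f \<longleftrightarrow> (\<forall>x. 0 \<le> f x) \<and> distributed P lborel X (\<lambda>x. ennreal (f x))"

definition rf_pdf :: "nat \<Rightarrow> nat \<Rightarrow> real \<Rightarrow> real \<Rightarrow> real \<Rightarrow> real" where
  "rf_pdf M m \<rho> \<mu>\<^sub>1 x =
     (if x < 0 then 0 else
      real m * real (M choose m) *
      (\<Sum>k = 0..m - 1.
        (- 1) ^ k * real ((m - 1) choose k) / ((real (M - m + k) * (1 - \<rho>) + 1) * \<mu>\<^sub>1) *
        exp (- (real (M - m + k + 1) * x / ((real (M - m + k) * (1 - \<rho>) + 1) * \<mu>\<^sub>1)))))"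

definition malaga_A :: "real \<Rightarrow> nat \<Rightarrow> real \<Rightarrow> real \<Rightarrow> real" where
  "malaga_A \<alpha> \<beta> g \<Omega>' =
     2 * \<alpha> powr (\<alpha> / 2) / (g powr (1 + \<alpha> / 2) * Gamma \<alpha>) *
     (g * real \<beta> / (g * real \<beta> + \<Omega>')) powr (real \<beta> + \<alpha> / 2)"

definition malaga_a :: "real \<Rightarrow> nat \<Rightarrow> real \<Rightarrow> real \<Rightarrow> nat \<Rightarrow> real" where
  "malaga_a \<alpha> \<beta> g \<Omega>' n =
     real ((\<beta> - 1) choose (n - 1)) *
     ((g * real \<beta> + \<Omega>') powr (1 - real n / 2) / fact (n - 1)) *
     (\<Omega>' / g) ^ (n - 1) * (\<alpha> / real \<beta>) powr (real n / 2)"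

definition malaga_b :: "real \<Rightarrow> nat \<Rightarrow> real \<Rightarrow> real \<Rightarrow> nat \<Rightarrow> real" where
  "malaga_b \<alpha> \<beta> g \<Omega>' n =
     malaga_a \<alpha> \<beta> g \<Omega>' n *
     ((g * real \<beta> + \<Omega>') / (\<alpha> * real \<beta>)) powr ((\<alpha> + real n) / 2)"

text \<open>
  The G-function is real here, because the parameters are real and the contour is symmetric under
  conjugation; \<open>Re\<close> only serves to obtain a real-valued density.
\<close>

definition malaga_pdf ::
  "nat \<Rightarrow> real \<Rightarrow> real \<Rightarrow> real \<Rightarrow> nat \<Rightarrow> real \<Rightarrow> real \<Rightarrow> real \<Rightarrow> real \<Rightarrow> real" where
  "malaga_pdf r \<mu>\<^sub>r \<xi> \<alpha> \<beta> g \<Omega>' B x =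
     (if x \<le> 0 then 0 else
      \<xi>\<^sup>2 * malaga_A \<alpha> \<beta> g \<Omega>' / (2 ^ r * x) *
      (\<Sum>n = 1..\<beta>.
        malaga_b \<alpha> \<beta> g \<Omega>' n *
        Re (meijer_G 3 0 [of_real (\<xi>\<^sup>2 + 1)] [of_real (\<xi>\<^sup>2), of_real \<alpha>, of_nat n]
              (B * (x / \<mu>\<^sub>r) powr (1 / real r)))))"

end

theory Submission
  imports Defs "HOL-Complex_Analysis.Complex_Analysis" "HOL-Real_Asymp.Real_Asymp"
begin

text \<open>
  Conditionally on \<open>\<gamma>\<^sub>2 = y\<close>, the SNR \<open>\<gamma>\<^sub>1\<close> is a signed mixture of exponentials of rates \<open>\<lambda>\<^sub>k\<close>.
  With \<open>q = C / \<kappa>\<close> and \<open>X = varpi \<mu>\<^sub>1 / \<zeta>\<^sub>3\<close>, integration by parts and a rescaling turn the mean of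
  \<open>ln (1 + varpi \<gamma>)\<close> under the \<open>k\<close>-th exponential law into the integral over \<open>v > 0\<close> of
  \<open>X exp (-(1 + q / y) v) / (1 + X v)\<close>.  The variable \<open>y\<close> now enters only through
  \<open>exp (- q v / y)\<close>, whose mean under the density of \<open>\<gamma>\<^sub>2\<close> is a single Mellin--Barnes integral in
  \<open>t\<close>: insert the contour integral of the G-function, integrate over \<open>y\<close> (which produces
  \<open>Gamma (- t)\<close> with \<open>s = - r t\<close>), and split \<open>Gamma (a - r t)\<close> by the duplication formula.  Finally
  \<open>1 / (1 + X v)\<close> is the Mellin--Barnes integral of \<open>Gamma (- s) Gamma (1 + s)\<close>, and the integral
  over \<open>v\<close> of \<open>exp (- v) v\<^sup>s\<^sup>+\<^sup>t\<close> supplies the joint factor \<open>Gamma (1 + s + t)\<close>.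
\<close>

subsection \<open>Gamma function on vertical lines\<close>

text \<open>The contours inside \<open>meijer_G\<close> and \<open>fox_H2\<close> come from a choice
  operator. The pair for the H-function is accepted as it is, because the evaluation works for every
  admissible pair; the line of the G-function then has to be moved to real part
  \<open>- r * \<tau>\<close>, by Cauchy's theorem. All line integrals are Lebesgue integrals, so
  each exchange needs absolute convergence. Quadratic decay of Gamma in the imaginary part is enough
  for this, and it follows from the functional equation without Stirling. Two places resist
  factorwise bounds. The reciprocal Gamma factors of the H-kernel grow along vertical lines, so its
  integrability is inherited from the G-kernel through duplication. The factor
  \<open>Gamma (1 + s + t)\<close> couples the two contours, so \<open>v\<close> is kept as the
  outermost variable while the contour integrals are still separate. The factor
  \<open>exp (- (q * v / y))\<close> has a second role: it makes \<open>y powr (\<tau> - 1)\<close>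
  integrable at 0, and so allows the density of the optical hop to be averaged term by term.\<close>

lemma borel_measurable_of_real_powr [measurable (raw)]:
  fixes f :: "'a \<Rightarrow> real" and g :: "'a \<Rightarrow> complex"
  assumes [measurable]: "f \<in> borel_measurable M" "g \<in> borel_measurable M"
  shows "(\<lambda>x. of_real (f x) powr g x) \<in> borel_measurable M"
proof -
  \<comment> \<open>The principal branch jumps across the negative axis, so measurability cannot
    come from continuity in the base. Splitting by the sign of the real base leaves three measurable
    formulas.\<close>
  have eq: "of_real a powr z =
      (if a = 0 then 0 else if a > 0 then exp (z * of_real (ln a))
       else exp (z * (of_real (ln (- a)) + \<i> * of_real pi)))" for a :: real and z :: complex
    using Ln_minus[of "complex_of_real (- a)"] Ln_of_real[of "- a"]
    by (auto simp: powr_def Ln_of_real not_less)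
  show ?thesis
    unfolding eq by measurable
qed

lemma has_bochner_integral_Gamma:
  assumes "0 < Re z"
  shows "has_bochner_integral lborel
    (\<lambda>v. indicator {0<..} v *\<^sub>R (of_real (exp (- v)) * of_real v powr (z - 1))) (Gamma z)"
proof -
  let ?f = "\<lambda>t. complex_of_real t powr (z - 1) / of_real (exp t)"
  have eq: "?f = (\<lambda>v. of_real (exp (- v)) * of_real v powr (z - 1))"
    by (auto simp: exp_minus field_simps)
  have abs: "?f absolutely_integrable_on {0<..}"
    using absolutely_integrable_Gamma_integral[OF assms, of 1] by simp
  have "set_integrable lborel {0<..} ?f"
    using abs unfolding set_integrable_def by (subst (asm) integrable_completion) auto
  moreover have "integral {0<..} ?f = Gamma z"
  proof -
    have "(?f has_integral Gamma z) {0<..}"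
      using Gamma_integral_complex[OF assms]
      by (subst has_integral_spike_set_eq[where T = "{0..}"])
         (auto intro: negligible_subset[of "{0}"])
    then show ?thesis by (rule integral_unique)
  qed
  ultimately show ?thesis
    using set_borel_integral_eq_integral(2)[of "{0<..}" ?f]
    by (simp add: eq has_bochner_integral_iff set_integrable_def set_lebesgue_integral_def)
qed

lemma norm_of_real_powr:
  "0 < x \<Longrightarrow> norm (of_real x powr s :: complex) = x powr Re s"
  by (simp add: norm_powr_real_powr)

lemma has_bochner_integral_Gamma_real:
  fixes x :: real
  assumes "0 < x"
  shows "has_bochner_integral lborel
    (\<lambda>v. indicator {0<..} v *\<^sub>R (exp (- v) * v powr (x - 1))) (Gamma x)"
proof -
  have "(\<lambda>v. Re (indicator {0<..} v *\<^sub>R (of_real (exp (- v)) * of_real v powr (of_real x - 1)))) =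
        (\<lambda>v. indicator {0<..} v *\<^sub>R (exp (- v) * v powr (x - 1)))" (is "?l = ?r")
  proof
    fix v :: real
    show "?l v = ?r v"
    proof (cases "v > 0")
      case True
      then have "complex_of_real v powr (of_real x - 1) = of_real (v powr (x - 1))"
        by (simp flip: powr_of_real)
      then show ?thesis by (simp add: indicator_def)
    qed simp
  qed
  moreover have "Re (Gamma (of_real x)) = Gamma x"
    by (simp add: Gamma_complex_of_real)
  ultimately show ?thesis
    using has_bochner_integral_Re[OF has_bochner_integral_Gamma[of "of_real x"]] assms by simp
qed

text \<open>In Euler's integral \<open>v powr (z - 1)\<close> has modulus
  \<open>v powr (Re z - 1)\<close>, so the imaginary part of \<open>z\<close> can only produce
  cancellation.\<close>

lemma norm_Gamma_le_Gamma_Re: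
  assumes "0 < Re z"
  shows "norm (Gamma z) \<le> Gamma (Re z)"
proof -
  let ?f = "\<lambda>v. indicator {0<..} v *\<^sub>R (of_real (exp (- v)) * complex_of_real v powr (z - 1))"
  have "norm (Gamma z) = norm (integral\<^sup>L lborel ?f)"
    using has_bochner_integral_Gamma[OF assms] by (simp add: has_bochner_integral_iff)
  also have "\<dots> \<le> (\<integral>v. norm (?f v) \<partial>lborel)"
    by (rule integral_norm_bound)
  also have "(\<lambda>v. norm (?f v)) = (\<lambda>v. indicator {0<..} v *\<^sub>R (exp (- v) * v powr (Re z - 1)))"
    by (auto simp: indicator_def norm_mult norm_of_real_powr)
  also have "(\<integral>v. \<dots> v \<partial>lborel) = Gamma (Re z)"
    using has_bochner_integral_Gamma_real[OF assms] by (simp add: has_bochner_integral_iff)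
  finally show ?thesis .
qed

text \<open>Since \<open>Gamma (z + 2) = z * (z + 1) * Gamma z\<close>, boundedness of the left side
  and |z| |z + 1| \<ge> (Im z)^2 give the decay; this is why Gamma is bounded on an interval
  reaching up to \<open>b + 2\<close>. A single factor of this kind makes a line integral
  converge.\<close>

lemma Gamma_decay_on_strip:
  assumes "0 < a"
  obtains K where "0 < K"
    "\<And>z. a \<le> Re z \<Longrightarrow> Re z \<le> b \<Longrightarrow> norm (Gamma z) \<le> K / (1 + (Im z)\<^sup>2)"
proof -
  have "continuous_on {a..b+2} (Gamma :: real \<Rightarrow> real)"
    using assms by (intro continuous_on_Gamma) (auto elim!: nonpos_Ints_cases)
  then have "bounded (Gamma ` {a..b+2})"
    by (intro compact_imp_bounded compact_continuous_image) auto
  then obtain K where K: "0 < K" "\<And>x. a \<le> x \<Longrightarrow> x \<le> b + 2 \<Longrightarrow> Gamma x \<le> K"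
    unfolding bounded_pos by (fastforce simp: abs_le_iff)
  have "norm (Gamma z) \<le> (2 * K) / (1 + (Im z)\<^sup>2)" if z: "a \<le> Re z" "Re z \<le> b" for z
  proof -
    have "0 < Re z" using z assms by simp
    then have nz: "z \<notin> \<int>\<^sub>\<le>\<^sub>0" "z + 1 \<notin> \<int>\<^sub>\<le>\<^sub>0" by (auto elim!: nonpos_Ints_cases simp: complex_eq_iff)
    have "norm (Gamma z) \<le> K"
      using norm_Gamma_le_Gamma_Re[OF \<open>0 < Re z\<close>] K(2)[of "Re z"] z by simp
    moreover have "norm (Gamma z) * (Im z)\<^sup>2 \<le> K"
    proof -
      have "(Im z)\<^sup>2 \<le> norm z * norm (z + 1)"
        using mult_mono[OF abs_Im_le_cmod[of z] abs_Im_le_cmod[of "z + 1"]]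
        by (simp add: power2_eq_square flip: abs_mult)
      then have "norm (Gamma z) * (Im z)\<^sup>2 \<le> norm (Gamma z) * (norm z * norm (z + 1))"
        by (intro mult_left_mono) auto
      also have "\<dots> = norm (Gamma (z + 2))"
        using Gamma_plus1[OF nz(1)] Gamma_plus1[OF nz(2)]
        by (simp add: norm_mult add.assoc mult_ac)
      also have "\<dots> \<le> K"
        using norm_Gamma_le_Gamma_Re[of "z + 2"] K(2)[of "Re z + 2"] z \<open>0 < Re z\<close> by simp
      finally show ?thesis .
    qed
    ultimately have "norm (Gamma z) * (1 + (Im z)\<^sup>2) \<le> 2 * K"
      by (simp add: algebra_simps)
    then show ?thesis
      by (subst pos_le_divide_eq) (auto simp: add_pos_nonneg)
  qed
  then show ?thesis using K(1) by (intro that[of "2 * K"]) auto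
qed

lemma integrable_inverse_one_plus_square:
  "integrable lborel (\<lambda>u::real. 1 / (1 + u\<^sup>2))"
proof -
  have "set_integrable lborel (einterval (- \<infinity>) \<infinity>) (\<lambda>x. 1 / (1 + x\<^sup>2))"
  proof (rule interval_integral_FTC_nonneg(1)[where F = arctan and A = "- pi / 2" and B = "pi / 2"])
    show "((arctan \<circ> real_of_ereal) \<longlongrightarrow> - pi / 2) (at_right (- \<infinity>))"
      using tendsto_arctan_at_bot by (simp add: ereal_tendsto_simps)
    show "((arctan \<circ> real_of_ereal) \<longlongrightarrow> pi / 2) (at_left \<infinity>)"
      using tendsto_arctan_at_top by (simp add: ereal_tendsto_simps)
    show "(arctan has_real_derivative 1 / (1 + x\<^sup>2)) (at x)" for x
      using DERIV_arctan[of x] by (simp add: inverse_eq_divide)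
    have "1 + x\<^sup>2 \<noteq> 0" for x :: real
      by (smt (verit) zero_le_power2)
    then show "isCont (\<lambda>x. 1 / (1 + x\<^sup>2)) x" for x :: real
      by (intro continuous_intros) auto
  qed auto
  then show ?thesis by (simp add: set_integrable_def)
qed

subsection \<open>Moving vertical lines across a pole\<close>

lemma one_plus_power2_gt_0 [simp]: "0 < 1 + (x::real)\<^sup>2"
  by (simp add: add_pos_nonneg)

lemma integrable_decay:
  fixes f :: "real \<Rightarrow> complex"
  assumes [measurable]: "f \<in> borel_measurable borel" and "\<And>u. norm (f u) \<le> K / (1 + u\<^sup>2)"
  shows "integrable lborel f"
proof (rule Bochner_Integration.integrable_bound)
  show "integrable lborel (\<lambda>u. K * (1 / (1 + u\<^sup>2)))"
    by (intro integrable_mult_right integrable_inverse_one_plus_square)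
  show "AE u in lborel. norm (f u) \<le> norm (K * (1 / (1 + u\<^sup>2)))"
    using assms(2) by (intro AE_I2 order.trans[OF assms(2)]) (auto intro!: divide_right_mono add_nonneg_nonneg)
qed simp

text \<open>Rectangular contours yield gauge integrals over bounded intervals; dominated convergence
  links them to the Lebesgue integral over the whole line.\<close>

lemma tendsto_integral_symmetric_interval:
  fixes f :: "real \<Rightarrow> complex"
  assumes f: "integrable lborel f"
  shows "(\<lambda>n. integral {- real n..real n} f) \<longlonglongrightarrow> integral\<^sup>L lborel f"
proof -
  note [measurable] = borel_measurable_integrable[OF f]
  have "(\<lambda>n. \<integral>u. indicator {- real n..real n} u *\<^sub>R f u \<partial>lborel) \<longlonglongrightarrow> integral\<^sup>L lborel f"
  proof (rule integral_dominated_convergence[where w = "\<lambda>u. norm (f u)"])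
    show "AE u in lborel. (\<lambda>n. indicator {- real n..real n} u *\<^sub>R f u) \<longlonglongrightarrow> f u"
    proof (rule AE_I2)
      fix u :: real
      have "\<forall>\<^sub>F n in sequentially. \<bar>u\<bar> \<le> real n"
        by (rule eventually_sequentiallyI[of "nat \<lceil>\<bar>u\<bar>\<rceil>"]) linarith
      then have "\<forall>\<^sub>F n in sequentially. indicator {- real n..real n} u *\<^sub>R f u = f u"
        by eventually_elim (auto simp: indicator_def)
      then show "(\<lambda>n. indicator {- real n..real n} u *\<^sub>R f u) \<longlonglongrightarrow> f u"
        by (rule tendsto_eventually)
    qed
    show "AE u in lborel. norm (indicator {- real n..real n} u *\<^sub>R f u) \<le> norm (f u)" for n
      by (auto simp: indicator_def)
  qed (use f in auto)
  moreover have "(\<integral>u. indicator {- real n..real n} u *\<^sub>R f u \<partial>lborel) = integral {- real n..real n} f" for n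
  proof -
    have "set_integrable lborel {- real n..real n} f"
      using f unfolding set_integrable_def by (intro integrable_mult_indicator) auto
    then show ?thesis
      using set_borel_integral_eq_integral(2) by (simp add: set_lebesgue_integral_def)
  qed
  ultimately show ?thesis by simp
qed

text \<open>
  If \<open>h\<close> vanishes at \<open>x0\<close>, there is no pole, and the two line integrals agree.
\<close>

lemma vertical_line_residue:
  fixes h :: "complex \<Rightarrow> complex" and a b x0 :: real
  defines "f \<equiv> \<lambda>s. h s / (s - of_real x0)"
  assumes holo: "h holomorphic_on {s. a' < Re s \<and> Re s < b'}"
    and ord: "a' < a" "a < x0" "x0 < b" "b < b'"
    and bound: "\<And>s. a \<le> Re s \<Longrightarrow> Re s \<le> b \<Longrightarrow> Re s = a \<or> Re s = b \<or> 1 \<le> \<bar>Im s\<bar> \<Longrightarrow>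
      norm (f s) \<le> K / (1 + (Im s)\<^sup>2)"
  shows "integrable lborel (\<lambda>u. f (Complex a u))"
    and "integrable lborel (\<lambda>u. f (Complex b u))"
    and "(\<integral>u. f (Complex b u) \<partial>lborel) - (\<integral>u. f (Complex a u) \<partial>lborel) = 2 * pi * h x0"
proof -
  define S where "S = {s. a' < Re s \<and> Re s < b'}"
  have S: "convex S" "open S"
  proof -
    have eq: "S = {s. a' < Re s} \<inter> {s. Re s < b'}" by (auto simp: S_def)
    show "convex S" unfolding eq
      by (intro convex_Int convex_halfspace_Re_gt convex_halfspace_Re_lt)
    show "open S" unfolding eq
      by (intro open_Int open_halfspace_Re_gt open_halfspace_Re_lt)
  qed
  have holf: "f holomorphic_on S - {of_real x0}"
    unfolding f_def using holo
    by (intro holomorphic_intros) (auto simp: S_def intro: holomorphic_on_subset)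
  have cont: "continuous_on A f" if "A \<subseteq> S - {of_real x0}" for A
    using holf that by (meson holomorphic_on_imp_continuous_on continuous_on_subset)
  have line: "integrable lborel (\<lambda>u. f (Complex c u))" if "c = a \<or> c = b" for c
  proof (rule integrable_decay[where K = K])
    have "continuous_on UNIV (\<lambda>u. f (Complex c u))"
      by (rule continuous_on_compose2[OF cont[of "range (Complex c)"]])
         (use that ord in \<open>auto simp: S_def complex_eq_iff intro!: continuous_intros\<close>)
    then show "(\<lambda>u. f (Complex c u)) \<in> borel_measurable borel"
      by (rule borel_measurable_continuous_onI)
    show "norm (f (Complex c u)) \<le> K / (1 + u\<^sup>2)" for u
      using bound[of "Complex c u"] that ord by auto
  qed
  then show "integrable lborel (\<lambda>u. f (Complex a u))" "integrable lborel (\<lambda>u. f (Complex b u))"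
    by auto
  define I where "I c n = integral {- real n..real n} (\<lambda>u. f (Complex c u))" for c n
  \<comment> \<open>Cauchy's formula on the rectangle of heights \<open>- n\<close> and
    \<open>n\<close>. The error consists of the two horizontal sides, each of length
    \<open>b - a\<close>; \<open>bound\<close> applies on them because
    \<open>n \<ge> 1\<close>.\<close>
  have rect: "norm (I b n - I a n - 2 * pi * h x0) \<le> 2 * (K * (b - a)) / (1 + (real n)\<^sup>2)"
    if "n \<ge> 1" for n
  proof -
    define N where "N = real n"
    have N: "N \<ge> 1" using that by (simp add: N_def)
    define p1 p2 p3 p4 where "p1 = Complex a (- N)" and "p2 = Complex b (- N)"
      and "p3 = Complex b N" and "p4 = Complex a N"
    note p = p1_def p2_def p3_def p4_def
    have rp: "rectpath p1 p3 = linepath p1 p2 +++ linepath p2 p3 +++ linepath p3 p4 +++ linepath p4 p1"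
      by (simp add: rectpath_def p Let_def)
    have seg: "closed_segment p1 p2 \<subseteq> {s. a \<le> Re s \<and> Re s \<le> b \<and> Im s = - N}"
      "closed_segment p3 p4 \<subseteq> {s. a \<le> Re s \<and> Re s \<le> b \<and> Im s = N}"
      "closed_segment p2 p3 \<subseteq> {s. Re s = b}" "closed_segment p4 p1 \<subseteq> {s. Re s = a}"
      using ord by (auto simp: p closed_segment_same_Re closed_segment_same_Im closed_segment_eq_real_ivl)
    have segS: "closed_segment p1 p2 \<subseteq> S - {of_real x0}" "closed_segment p2 p3 \<subseteq> S - {of_real x0}"
      "closed_segment p3 p4 \<subseteq> S - {of_real x0}" "closed_segment p4 p1 \<subseteq> S - {of_real x0}"
      using seg ord N by (fastforce simp: S_def)+
    have int: "f contour_integrable_on linepath p1 p2" "f contour_integrable_on linepath p2 p3"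
      "f contour_integrable_on linepath p3 p4" "f contour_integrable_on linepath p4 p1"
      using segS by (auto intro!: contour_integrable_continuous_linepath cont)
    have "path_image (rectpath p1 p3) \<subseteq> S - {of_real x0}"
      using segS unfolding rp by (auto simp: path_image_join)
    moreover have "of_real x0 \<in> box p1 p3"
      using ord N by (auto simp: p in_box_complex_iff)
    ultimately have "(f has_contour_integral (2 * pi * \<i> * h x0)) (rectpath p1 p3)"
      using Cauchy_integral_formula_convex_simple[of S h "of_real x0" "rectpath p1 p3"] holo S ord
        winding_number_rectpath[of "of_real x0" p1 p3]
      unfolding f_def by (auto simp: S_def interior_open)
    then have "2 * pi * \<i> * h x0 = contour_integral (rectpath p1 p3) f"
      by (simp add: contour_integral_unique)
    also have "\<dots> = contour_integral (linepath p1 p2) f + contour_integral (linepath p2 p3) f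
        + contour_integral (linepath p3 p4) f + contour_integral (linepath p4 p1) f"
      using int by (simp add: rp)
    also have "contour_integral (linepath p2 p3) f = \<i> * I b n"
      unfolding I_def by (subst contour_integral_linepath_same_Re[of _ b _ "- N" N]) (use N in \<open>auto simp: p N_def\<close>)
    also have "contour_integral (linepath p4 p1) f = - contour_integral (linepath p1 p4) f"
      using segS by (subst contour_integral_reverse_linepath) (auto intro: cont simp: closed_segment_commute)
    also have "contour_integral (linepath p1 p4) f = \<i> * I a n"
      unfolding I_def by (subst contour_integral_linepath_same_Re[of _ a _ "- N" N]) (use N in \<open>auto simp: p N_def\<close>)
    finally have eq: "\<i> * (I b n - I a n - 2 * pi * h x0) =
        - (contour_integral (linepath p1 p2) f + contour_integral (linepath p3 p4) f)"
      by (simp add: algebra_simps)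
    have K: "0 \<le> K"
      using order.trans[OF norm_ge_zero bound[of "Complex a 0"]] ord by simp
    have "norm (contour_integral (linepath p1 p2) f) \<le> K / (1 + N\<^sup>2) * norm (p2 - p1)"
    proof (rule contour_integral_bound_linepath)
      fix s assume "s \<in> closed_segment p1 p2"
      then have "a \<le> Re s" "Re s \<le> b" "Im s = - N" using seg by auto
      then show "norm (f s) \<le> K / (1 + N\<^sup>2)"
        using bound[of s] N by simp
    qed (use int K in \<open>auto intro!: divide_nonneg_nonneg add_nonneg_nonneg\<close>)
    moreover have "norm (contour_integral (linepath p3 p4) f) \<le> K / (1 + N\<^sup>2) * norm (p4 - p3)"
    proof (rule contour_integral_bound_linepath)
      fix s assume "s \<in> closed_segment p3 p4"
      then have "a \<le> Re s" "Re s \<le> b" "Im s = N" using seg by auto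
      then show "norm (f s) \<le> K / (1 + N\<^sup>2)"
        using bound[of s] N by simp
    qed (use int K in \<open>auto intro!: divide_nonneg_nonneg add_nonneg_nonneg\<close>)
    moreover have "norm (p2 - p1) = b - a" "norm (p4 - p3) = b - a"
      using ord by (auto simp: p cmod_def)
    moreover have "norm (I b n - I a n - 2 * pi * h x0) =
        norm (contour_integral (linepath p1 p2) f + contour_integral (linepath p3 p4) f)"
      using arg_cong[OF eq, of norm] by (simp only: norm_mult norm_minus_cancel) simp
    ultimately have "norm (I b n - I a n - 2 * pi * h x0) \<le> K / (1 + N\<^sup>2) * (b - a) + K / (1 + N\<^sup>2) * (b - a)"
      using norm_triangle_ineq[of "contour_integral (linepath p1 p2) f" "contour_integral (linepath p3 p4) f"]
      by simp
    then show ?thesis by (simp add: N_def)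
  qed
  have "(\<lambda>n. 2 * (K * (b - a)) / (1 + (real n)\<^sup>2)) \<longlonglongrightarrow> 0"
    by real_asymp
  then have "(\<lambda>n. I b n - I a n - 2 * pi * h x0) \<longlonglongrightarrow> 0"
    by (rule Lim_null_comparison[rotated]) (use rect in \<open>auto intro!: eventually_sequentiallyI[of 1]\<close>)
  moreover have "(\<lambda>n. I b n - I a n - 2 * pi * h x0) \<longlonglongrightarrow>
      (\<integral>u. f (Complex b u) \<partial>lborel) - (\<integral>u. f (Complex a u) \<partial>lborel) - 2 * pi * h x0"
    unfolding I_def by (intro tendsto_intros tendsto_integral_symmetric_interval line) auto
  ultimately show "(\<integral>u. f (Complex b u) \<partial>lborel) - (\<integral>u. f (Complex a u) \<partial>lborel) = 2 * pi * h x0"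
    using LIMSEQ_unique by fastforce
qed

text \<open>A power is monotone in its exponent, in a direction that depends on whether
  \<open>z \<le> 1\<close>; the sum of the endpoint values covers both cases. The result is a bound
  for \<open>z powr x\<close> that is uniform over a strip.\<close>

lemma powr_le_add_endpoints:
  fixes z x y1 y2 :: real
  assumes "0 < z" "y1 \<le> x" "x \<le> y2"
  shows "z powr x \<le> z powr y1 + z powr y2"
proof (cases "z \<le> 1")
  case True
  then have "z powr x \<le> z powr y1" using assms by (intro powr_mono') auto
  then show ?thesis by (simp add: add_increasing2)
next
  case False
  then have "z powr x \<le> z powr y2" using assms by (intro powr_mono) auto
  then show ?thesis by (simp add: add_increasing)
qed

lemma notin_nonpos_Ints_complex: "0 < Re z \<Longrightarrow> z \<notin> \<int>\<^sub>\<le>\<^sub>0"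
  by (auto elim!: nonpos_Ints_cases)

lemma Gamma_plus1_complex: "0 < Re z \<Longrightarrow> Gamma (z + 1) = z * Gamma z"
  by (rule Gamma_plus1) (rule notin_nonpos_Ints_complex)

lemma holomorphic_on_of_real_powr [holomorphic_intros]:
  assumes "0 < z" "f holomorphic_on A"
  shows "(\<lambda>s. complex_of_real z powr f s) holomorphic_on A"
  using assms by (simp add: powr_def holomorphic_intros)

text \<open>
  Multiplying the integral by \<open>w\<close> moves its line to \<open>\<sigma> + 1\<close> and flips the sign of the kernel, so
  \<open>(1 + w)\<close> times the integral is the residue at \<open>0\<close>.
\<close>

lemma inverse_Mellin_geometric:
  assumes \<sigma>: "- 1 < \<sigma>" "\<sigma> < 0" and w: "0 < w"
  defines "A \<equiv> \<lambda>s. Gamma (- s) * Gamma (1 + s)"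
  shows "integrable lborel (\<lambda>u. A (Complex \<sigma> u) * of_real w powr Complex \<sigma> u)"
    and "(\<integral>u. A (Complex \<sigma> u) * of_real w powr Complex \<sigma> u \<partial>lborel) = 2 * pi / (1 + w)"
proof -
  \<comment> \<open>\<open>Gamma (1 - s) = - s * Gamma (- s)\<close>, so \<open>h s / s\<close> is
    minus the integrand, and the pole at 0 sits in the denominator alone.\<close>
  define h where "h s = Gamma (1 - s) * Gamma (1 + s) * of_real w powr s" for s :: complex
  obtain K1 where K1: "0 < K1"
    "\<And>z. - \<sigma> \<le> Re z \<Longrightarrow> Re z \<le> 1 - \<sigma> \<Longrightarrow> norm (Gamma z) \<le> K1 / (1 + (Im z)\<^sup>2)"
    using Gamma_decay_on_strip[of "- \<sigma>" "1 - \<sigma>"] \<sigma> by auto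
  obtain K2 where K2: "0 < K2"
    "\<And>z. 1 + \<sigma> \<le> Re z \<Longrightarrow> Re z \<le> 2 + \<sigma> \<Longrightarrow> norm (Gamma z) \<le> K2 / (1 + (Im z)\<^sup>2)"
    using Gamma_decay_on_strip[of "1 + \<sigma>" "2 + \<sigma>"] \<sigma> by auto
  define W where "W = w powr \<sigma> + w powr (\<sigma> + 1)"
  \<comment> \<open>A lower bound for |s|: on the two lines |Re s| is \<open>- \<sigma>\<close> or
    \<open>1 + \<sigma>\<close>, and at the remaining points |Im s| is at least 1.\<close>
  define \<delta> where "\<delta> = min (- \<sigma>) (1 + \<sigma>)"
  have \<delta>: "0 < \<delta>" "\<delta> \<le> 1" using \<sigma> by (auto simp: \<delta>_def)
  have holo: "h holomorphic_on {s. - 1 < Re s \<and> Re s < 1}"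
    unfolding h_def using w by (intro holomorphic_intros notin_nonpos_Ints_complex) auto
  have bound: "norm (h s / (s - of_real 0)) \<le> (K1 * K2 * W / \<delta>) / (1 + (Im s)\<^sup>2)"
    if s: "\<sigma> \<le> Re s" "Re s \<le> \<sigma> + 1" "Re s = \<sigma> \<or> Re s = \<sigma> + 1 \<or> 1 \<le> \<bar>Im s\<bar>" for s
  proof -
    have "norm (Gamma (1 - s)) \<le> K1 / (1 + (Im s)\<^sup>2)"
      using K1(2)[of "1 - s"] s by simp
    moreover have "norm (Gamma (1 + s)) \<le> K2"
    proof -
      have "K2 / (1 + (Im s)\<^sup>2) \<le> K2 / 1"
        using K2(1) by (intro divide_left_mono) auto
      then show ?thesis using K2(2)[of "1 + s"] s by simp
    qed
    moreover have "norm (of_real w powr s) \<le> W"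
      using powr_le_add_endpoints[OF w s(1,2)] w by (simp add: norm_of_real_powr W_def)
    moreover have "\<delta> \<le> norm s"
      using s abs_Re_le_cmod[of s] abs_Im_le_cmod[of s] \<delta> by (auto simp: \<delta>_def)
    moreover have "0 \<le> W" by (simp add: W_def)
    ultimately have "norm (Gamma (1 - s)) * norm (Gamma (1 + s)) * norm (of_real w powr s) / norm s
        \<le> (K1 / (1 + (Im s)\<^sup>2)) * K2 * W / \<delta>"
      using \<delta> K1(1) K2(1) by (intro frac_le mult_mono mult_nonneg_nonneg) (auto simp: add_nonneg_nonneg)
    then show ?thesis by (simp add: h_def norm_mult norm_divide mult_ac)
  qed
  note res = vertical_line_residue[of h "-1" 1 \<sigma> 0 "\<sigma> + 1", OF holo \<sigma>(1) \<sigma>(2) _ _ bound]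
  define F where "F u = A (Complex \<sigma> u) * of_real w powr Complex \<sigma> u" for u
  have left: "h (Complex \<sigma> u) / (Complex \<sigma> u - of_real 0) = - F u" for u
  proof -
    have "Gamma (- Complex \<sigma> u + 1) = - Complex \<sigma> u * Gamma (- Complex \<sigma> u)"
      using \<sigma> by (intro Gamma_plus1_complex) auto
    moreover have "Complex \<sigma> u \<noteq> 0" using \<sigma> by (simp add: complex_eq_iff)
    ultimately show ?thesis by (simp add: h_def F_def A_def)
  qed
  \<comment> \<open>With \<open>s + 1\<close> in place of \<open>s\<close>, the factor
    \<open>1 + s\<close> split off from \<open>Gamma (2 + s)\<close> cancels the denominator, and
    one extra power of \<open>w\<close> remains.\<close>
  have right: "h (Complex (\<sigma> + 1) u) / (Complex (\<sigma> + 1) u - of_real 0) = w * F u" for u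
  proof -
    define s where "s = Complex \<sigma> u"
    have eq: "Complex (\<sigma> + 1) u = s + 1" by (simp add: s_def complex_eq_iff)
    have "Gamma ((1 + s) + 1) = (1 + s) * Gamma (1 + s)"
      using \<sigma> by (intro Gamma_plus1_complex) (auto simp: s_def)
    then have "Gamma (1 + (s + 1)) = (1 + s) * Gamma (1 + s)" by (simp add: add_ac)
    moreover have "1 + s \<noteq> 0" using \<sigma> by (simp add: complex_eq_iff s_def)
    ultimately show ?thesis
      using w unfolding eq by (simp add: h_def F_def A_def powr_add add_ac flip: s_def)
  qed
  have "integrable lborel F"
    using res(1) \<sigma> integrable_minus[of lborel "\<lambda>u. - F u"] unfolding left by auto
  then show "integrable lborel (\<lambda>u. A (Complex \<sigma> u) * of_real w powr Complex \<sigma> u)"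
    unfolding F_def .
  have "w * (\<integral>u. F u \<partial>lborel) + (\<integral>u. F u \<partial>lborel) = 2 * pi * h 0"
    using res(3) \<sigma> unfolding left right by simp
  then have "(1 + of_real w) * (\<integral>u. F u \<partial>lborel) = 2 * pi"
    using w by (simp add: h_def algebra_simps powr_def)
  moreover have "1 + complex_of_real w \<noteq> 0"
    using w by (simp add: complex_eq_iff)
  ultimately show "(\<integral>u. A (Complex \<sigma> u) * of_real w powr Complex \<sigma> u \<partial>lborel) = 2 * pi / (1 + w)"
    by (simp add: F_def field_simps)
qed

section \<open>The G-function of the optical density as a line integral\<close>

text \<open>
  The kernel of the G-function in the optical density, with \<open>Gamma (a + s) / Gamma (a + 1 + s)\<close>
  cancelled to \<open>1 / (a + s)\<close>, so that the decay of \<open>Gamma\<close> alone makes it integrable.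
\<close>

definition turbulence_kernel :: "real \<Rightarrow> real \<Rightarrow> real \<Rightarrow> complex \<Rightarrow> complex" where
  "turbulence_kernel a b d s = Gamma (of_real b + s) * Gamma (of_real d + s) / (of_real a + s)"

text \<open>One Gamma factor supplies the decay. The other is merely bounded on the strip, and |a +
  s| is at least \<open>a + c1\<close> there.\<close>

lemma turbulence_kernel_decay:
  assumes "- a < c1" "- b < c1" "- d < c1"
  obtains K where "0 < K"
    "\<And>s. c1 \<le> Re s \<Longrightarrow> Re s \<le> c2 \<Longrightarrow> norm (turbulence_kernel a b d s) \<le> K / (1 + (Im s)\<^sup>2)"
proof -
  obtain K1 where K1: "0 < K1"
    "\<And>z. b + c1 \<le> Re z \<Longrightarrow> Re z \<le> b + c2 \<Longrightarrow> norm (Gamma z) \<le> K1 / (1 + (Im z)\<^sup>2)"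
    using Gamma_decay_on_strip[of "b + c1" "b + c2"] assms by auto
  obtain K2 where K2: "0 < K2"
    "\<And>z. d + c1 \<le> Re z \<Longrightarrow> Re z \<le> d + c2 \<Longrightarrow> norm (Gamma z) \<le> K2 / (1 + (Im z)\<^sup>2)"
    using Gamma_decay_on_strip[of "d + c1" "d + c2"] assms by auto
  show thesis
  proof (rule that[of "K1 * K2 / (a + c1)"])
    fix s assume s: "c1 \<le> Re s" "Re s \<le> c2"
    have "norm (Gamma (of_real b + s)) \<le> K1 / (1 + (Im s)\<^sup>2)"
      using K1(2)[of "of_real b + s"] s by simp
    moreover have "norm (Gamma (of_real d + s)) \<le> K2"
    proof -
      have "K2 / (1 + (Im s)\<^sup>2) \<le> K2 / 1"
        using K2(1) by (intro divide_left_mono) auto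
      then show ?thesis using K2(2)[of "of_real d + s"] s by simp
    qed
    moreover have "a + c1 \<le> norm (of_real a + s)"
      using s abs_Re_le_cmod[of "of_real a + s"] by simp
    ultimately have "norm (Gamma (of_real b + s)) * norm (Gamma (of_real d + s)) / norm (of_real a + s)
        \<le> (K1 / (1 + (Im s)\<^sup>2)) * K2 / (a + c1)"
      using assms K1(1) K2(1)
      by (intro frac_le mult_mono mult_nonneg_nonneg) (auto simp: add_nonneg_nonneg)
    then show "norm (turbulence_kernel a b d s) \<le> K1 * K2 / (a + c1) / (1 + (Im s)\<^sup>2)"
      by (simp add: turbulence_kernel_def norm_mult norm_divide mult_ac)
  qed (use K1 K2 assms in auto)
qed

lemma turbulence_kernel_holomorphic:
  "turbulence_kernel a b d holomorphic_on {s. - a < Re s \<and> - b < Re s \<and> - d < Re s}"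
  unfolding turbulence_kernel_def
  by (intro holomorphic_intros notin_nonpos_Ints_complex) (auto simp: complex_eq_iff)

lemma turbulence_kernel_measurable [measurable]:
  assumes "- a < c" "- b < c" "- d < c"
  shows "(\<lambda>u. turbulence_kernel a b d (Complex c u)) \<in> borel_measurable borel"
proof (rule borel_measurable_continuous_onI)
  show "continuous_on UNIV (\<lambda>u. turbulence_kernel a b d (Complex c u))"
    by (rule continuous_on_compose2[OF holomorphic_on_imp_continuous_on[OF turbulence_kernel_holomorphic]])
       (use assms in \<open>auto intro!: continuous_intros\<close>)
qed

lemma turbulence_kernel_integrable:
  assumes "- a < c" "- b < c" "- d < c"
  shows "integrable lborel (\<lambda>u. turbulence_kernel a b d (Complex c u))"
proof -
  obtain K where K: "\<And>s. c \<le> Re s \<Longrightarrow> Re s \<le> c \<Longrightarrow> norm (turbulence_kernel a b d s) \<le> K / (1 + (Im s)\<^sup>2)"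
    using turbulence_kernel_decay[OF assms, of c] by blast
  show ?thesis
  proof (rule integrable_decay)
    show "norm (turbulence_kernel a b d (Complex c u)) \<le> K / (1 + u\<^sup>2)" for u
      using K[of "Complex c u"] by simp
  qed (rule turbulence_kernel_measurable[OF assms])
qed

text \<open>The integrand has no pole between the lines, whereas
  \<open>vertical_line_residue\<close> is phrased for one. The midpoint \<open>x0\<close> acts as a
  fictitious pole: \<open>h s = f s * (s - x0)\<close> vanishes there, so the difference of the
  integrals is 0.\<close>

lemma turbulence_integral_shift:
  assumes ord: "- a < c1" "- b < c1" "- d < c1" "c1 < c2" and z: "0 < z"
  shows "(\<integral>u. turbulence_kernel a b d (Complex c1 u) * of_real z powr - Complex c1 u \<partial>lborel) =
    (\<integral>u. turbulence_kernel a b d (Complex c2 u) * of_real z powr - Complex c2 u \<partial>lborel)"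
proof -
  define f where "f s = turbulence_kernel a b d s * of_real z powr - s" for s :: complex
  define x0 where "x0 = (c1 + c2) / 2"
  have x0: "c1 < x0" "x0 < c2" using ord by (auto simp: x0_def)
  define h where "h s = f s * (s - of_real x0)" for s
  obtain K where K: "0 < K"
    "\<And>s. c1 \<le> Re s \<Longrightarrow> Re s \<le> c2 \<Longrightarrow> norm (turbulence_kernel a b d s) \<le> K / (1 + (Im s)\<^sup>2)"
    using turbulence_kernel_decay[OF ord(1-3), of c2] by blast
  define W where "W = z powr - c2 + z powr - c1"
  define a' where "a' = Max {- a, - b, - d}"
  have a': "a' < c1" using ord by (auto simp: a'_def)
  have "f holomorphic_on {s. a' < Re s \<and> Re s < c2 + 1}"
    unfolding f_def using z
    by (intro holomorphic_intros holomorphic_on_subset[OF turbulence_kernel_holomorphic])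
       (auto simp: a'_def)
  then have holo: "h holomorphic_on {s. a' < Re s \<and> Re s < c2 + 1}"
    unfolding h_def by (intro holomorphic_intros)
  have bound: "norm (h s / (s - of_real x0)) \<le> K * W / (1 + (Im s)\<^sup>2)"
    if s: "c1 \<le> Re s" "Re s \<le> c2" "Re s = c1 \<or> Re s = c2 \<or> 1 \<le> \<bar>Im s\<bar>" for s
  proof -
    have "norm (h s / (s - of_real x0)) \<le> norm (f s)"
      by (simp add: h_def norm_mult norm_divide)
    also have "\<dots> = norm (turbulence_kernel a b d s) * z powr - Re s"
      using z by (simp add: f_def norm_mult norm_of_real_powr)
    also have "\<dots> \<le> K / (1 + (Im s)\<^sup>2) * W"
      using K s powr_le_add_endpoints[OF z, of "- c2" "- Re s" "- c1"]
      unfolding W_def by (intro mult_mono) (auto simp: add_nonneg_nonneg)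
    finally show ?thesis by (simp add: mult_ac)
  qed
  have eq: "h (Complex c u) / (Complex c u - of_real x0) = f (Complex c u)" if "c \<noteq> x0" for c u
    using that by (simp add: h_def complex_eq_iff)
  have "(\<integral>u. f (Complex c2 u) \<partial>lborel) - (\<integral>u. f (Complex c1 u) \<partial>lborel) = 2 * pi * h x0"
    using vertical_line_residue(3)[OF holo a' x0 _ bound] x0 by (simp add: eq)
  then show ?thesis by (simp add: h_def f_def)
qed

lemma turbulence_integral_line_independent:
  assumes "- a < c1" "- b < c1" "- d < c1" "- a < c2" "- b < c2" "- d < c2" "0 < z"
  shows "(\<integral>u. turbulence_kernel a b d (Complex c1 u) * of_real z powr - Complex c1 u \<partial>lborel) =
    (\<integral>u. turbulence_kernel a b d (Complex c2 u) * of_real z powr - Complex c2 u \<partial>lborel)"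
proof (cases c1 c2 rule: linorder_cases)
  case less
  show ?thesis by (rule turbulence_integral_shift[OF assms(1-3) less assms(7)])
next
  case greater
  show ?thesis by (rule turbulence_integral_shift[OF assms(4-6) greater assms(7), symmetric])
qed simp

text \<open>The line picked by \<open>SOME\<close> is unknown; line independence replaces it by any
  admissible \<open>c\<close>. The later value \<open>c = - r * \<tau>\<close> is dictated by the
  contour of the H-function.\<close>

lemma meijer_G_eq_integral:
  assumes "- a < c" "- b < c" "- d < c" "0 < z"
  shows "meijer_G 3 0 [of_real (a + 1)] [of_real a, of_real b, of_real d] z =
    1 / (2 * pi) * (\<integral>u. turbulence_kernel a b d (Complex c u) * of_real z powr - Complex c u \<partial>lborel)"
proof -
  let ?line = "meijer_G_line 3 0 [of_real (a + 1)] [of_real a, of_real b, of_real d]"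
  have line: "?line x \<longleftrightarrow> - a < x \<and> - b < x \<and> - d < x" for x
    by (auto simp: meijer_G_line_def)
  define c0 where "c0 = (SOME x. ?line x)"
  have "?line c0"
    unfolding c0_def by (rule someI[of ?line c]) (use assms line in auto)
  then have c0: "- a < c0" "- b < c0" "- d < c0"
    unfolding line by auto
  have kernel: "meijer_G_kernel 3 0 [of_real (a + 1)] [of_real a, of_real b, of_real d] s =
      turbulence_kernel a b d s" if "- a < Re s" for s
  proof -
    have "Gamma ((of_real a + s) + 1) = (of_real a + s) * Gamma (of_real a + s)"
      using that by (intro Gamma_plus1_complex) auto
    moreover have "Gamma (of_real a + s) \<noteq> 0"
      using that by (subst Gamma_eq_zero_iff) (intro notin_nonpos_Ints_complex, simp)
    ultimately show ?thesis
      by (simp add: meijer_G_kernel_def turbulence_kernel_def add_ac)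
  qed
  have "meijer_G 3 0 [of_real (a + 1)] [of_real a, of_real b, of_real d] z =
      1 / (2 * pi) * (\<integral>u. turbulence_kernel a b d (Complex c0 u) * of_real z powr - Complex c0 u \<partial>lborel)"
  proof -
    have "- a < Re (Complex c0 u)" for u using c0 by simp
    note kernel[OF this]
    then show ?thesis
      unfolding meijer_G_def vline_integral_def c0_def[symmetric] by simp
  qed
  then show ?thesis
    using turbulence_integral_line_independent[OF c0 assms(1-4)] by simp
qed

lemma cnj_of_real_powr: "0 < z \<Longrightarrow> cnj (of_real z powr s) = of_real z powr cnj s"
  by (simp add: powr_def Ln_of_real exp_cnj)

lemma cnj_turbulence_kernel: "cnj (turbulence_kernel a b d s) = turbulence_kernel a b d (cnj s)"
  by (simp add: turbulence_kernel_def cnj_Gamma)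

text \<open>For positive parameters the imaginary axis is an admissible line, and conjugation acts
  on it as \<open>u\<close> to \<open>- u\<close>. This lets the \<open>Re\<close> in the density
  pass through complex integrals.\<close>

lemma meijer_G_in_Reals:
  assumes "0 < a" "0 < b" "0 < d" "0 < z"
  shows "meijer_G 3 0 [of_real (a + 1)] [of_real a, of_real b, of_real d] z \<in> \<real>"
proof -
  define F where "F s = turbulence_kernel a b d s * of_real z powr - s" for s :: complex
  define I where "I = (\<integral>u. F (Complex 0 u) \<partial>lborel)"
  have cnj_F: "cnj (F s) = F (cnj s)" for s
    using \<open>0 < z\<close> by (simp add: F_def cnj_turbulence_kernel cnj_of_real_powr)
  have "cnj I = (\<integral>u. F (Complex 0 (- u)) \<partial>lborel)"
    unfolding I_def Bochner_Integration.integral_cnj[symmetric] cnj_F complex_cnj by simp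
  also have "\<dots> = I"
    using lborel_integral_real_affine[of "-1" "\<lambda>u. F (Complex 0 u)" 0] by (simp add: I_def)
  finally have "I \<in> \<real>"
    by (simp add: Reals_cnj_iff)
  moreover have "meijer_G 3 0 [of_real (a + 1)] [of_real a, of_real b, of_real d] z = 1 / (2 * pi) * I"
    unfolding I_def F_def by (rule meijer_G_eq_integral) (use assms in auto)
  ultimately show ?thesis
    by (metis Reals_mult Reals_of_real)
qed

subsection \<open>Mellin--Barnes integrals and Laplace transforms\<close>

text \<open>The integrands are signed or complex, so a dominating function is required. A separated
  one is at hand for the contour integrals: on a vertical line |x^s| depends on \<open>x\<close>
  alone.\<close>

lemma Fubini_product_bound:
  fixes F :: "real \<Rightarrow> real \<Rightarrow> 'b::{banach, second_countable_topology}" and f g :: "real \<Rightarrow> real"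
  assumes F[measurable]: "case_prod F \<in> borel_measurable (lborel \<Otimes>\<^sub>M lborel)"
    and f: "integrable lborel f" and g: "integrable lborel g"
    and le: "\<And>x y. norm (F x y) \<le> f x * g y"
  shows "integrable (lborel \<Otimes>\<^sub>M lborel) (case_prod F)"
    and "(\<integral>x. (\<integral>y. F x y \<partial>lborel) \<partial>lborel) = (\<integral>y. (\<integral>x. F x y \<partial>lborel) \<partial>lborel)"
    and "integrable lborel (\<lambda>x. \<integral>y. F x y \<partial>lborel)"
proof -
  have [measurable]: "f \<in> borel_measurable borel" "g \<in> borel_measurable borel"
    using f g by (auto dest: borel_measurable_integrable)
  have "integrable (lborel \<Otimes>\<^sub>M lborel) (\<lambda>(x, y). f x * g y)"
    by (rule lborel_pair.Fubini_integrable) (use f g in \<open>auto simp: abs_mult\<close>)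
  then show int: "integrable (lborel \<Otimes>\<^sub>M lborel) (case_prod F)"
    by (rule Bochner_Integration.integrable_bound)
       (auto intro!: AE_I2 order.trans[OF le] simp: real_norm_def)
  then show "(\<integral>x. (\<integral>y. F x y \<partial>lborel) \<partial>lborel) = (\<integral>y. (\<integral>x. F x y \<partial>lborel) \<partial>lborel)"
    by (rule lborel_pair.Fubini_integral[symmetric])
  show "integrable lborel (\<lambda>x. \<integral>y. F x y \<partial>lborel)"
    using lborel_pair.integrable_fst'[OF int] by simp
qed

lemma of_real_mult_powr:
  "0 < x \<Longrightarrow> 0 < y \<Longrightarrow> of_real (x * y) powr s = of_real x powr s * (of_real y powr s :: complex)"
  by (simp add: powr_times_real)

text \<open>The inner half of the double integral, with the first contour variable frozen in
  \<open>z\<close>. After the exchange the \<open>v\<close>-integral is Euler's integral at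
  \<open>1 + z + t\<close>, and \<open>pos\<close> is its convergence at 0.\<close>

lemma laplace_inverse_Mellin:
  fixes D :: "real \<Rightarrow> complex"
  assumes D: "integrable lborel D" and pos: "0 < 1 + Re z + \<tau>" and Y: "0 < Y"
  shows "(\<integral>v. indicator {0<..} v *\<^sub>R (of_real (exp (- v)) * of_real v powr z *
      (\<integral>w. D w * of_real (Y * v) powr Complex \<tau> w \<partial>lborel)) \<partial>lborel) =
    (\<integral>w. D w * of_real Y powr Complex \<tau> w * Gamma (1 + z + Complex \<tau> w) \<partial>lborel)"
proof -
  have [measurable]: "D \<in> borel_measurable borel" "Complex \<tau> \<in> borel_measurable borel"
    using D by (auto dest: borel_measurable_integrable
      intro!: borel_measurable_continuous_onI continuous_intros)
  define F where "F v w = indicator {0<..} v *\<^sub>R (of_real (exp (- v)) * of_real v powr z *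
    (D w * of_real (Y * v) powr Complex \<tau> w))" for v w
  have "(\<integral>v. (\<integral>w. F v w \<partial>lborel) \<partial>lborel) = (\<integral>w. (\<integral>v. F v w \<partial>lborel) \<partial>lborel)"
  proof (rule Fubini_product_bound(2))
    show "case_prod F \<in> borel_measurable (lborel \<Otimes>\<^sub>M lborel)"
      unfolding F_def by measurable
    show "integrable lborel (\<lambda>v. indicator {0<..} v *\<^sub>R (exp (- v) * v powr ((1 + Re z + \<tau>) - 1)))"
      using has_bochner_integral_Gamma_real[OF pos] by (simp add: has_bochner_integral_iff)
    show "integrable lborel (\<lambda>w. Y powr \<tau> * norm (D w))"
      using D by simp
    show "norm (F v w) \<le> indicator {0<..} v *\<^sub>R (exp (- v) * v powr ((1 + Re z + \<tau>) - 1)) *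
        (Y powr \<tau> * norm (D w))" for v w
    proof (cases "0 < v")
      case True
      then have "norm (F v w) = exp (- v) * (v powr Re z * norm (D w) * (Y * v) powr \<tau>)"
        using Y by (simp add: F_def norm_mult norm_of_real_powr del: of_real_mult)
      also have "\<dots> = exp (- v) * v powr (Re z + \<tau>) * (Y powr \<tau> * norm (D w))"
        using True Y by (simp add: powr_mult powr_add mult_ac)
      finally show ?thesis using True by simp
    qed (simp add: F_def)
  qed
  moreover have "(\<integral>v. F v w \<partial>lborel) = D w * of_real Y powr Complex \<tau> w * Gamma (1 + z + Complex \<tau> w)" for w
  proof -
    let ?t = "Complex \<tau> w"
    have F_eq: "F v w = D w * of_real Y powr ?t *
        (indicator {0<..} v *\<^sub>R (of_real (exp (- v)) * of_real v powr ((1 + z + ?t) - 1)))" for v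
      using Y by (cases "0 < v") (simp_all add: F_def of_real_mult_powr powr_add mult_ac del: of_real_mult)
    have "(\<integral>v. F v w \<partial>lborel) = D w * of_real Y powr ?t *
        (\<integral>v. indicator {0<..} v *\<^sub>R (of_real (exp (- v)) * of_real v powr ((1 + z + ?t) - 1)) \<partial>lborel)"
      unfolding F_eq by (simp only: mult_scaleR_right[symmetric] integral_mult_right_zero)
    then show ?thesis
      using has_bochner_integral_Gamma[of "1 + z + ?t"] pos by (simp add: has_bochner_integral_iff)
  qed
  ultimately show ?thesis
    by (simp add: F_def)
qed

text \<open>Writing \<open>Gamma (1 + s + t)\<close> as an integral over \<open>v\<close> uncouples
  the contours. Fubini is then used twice, each time for two variables: \<open>v\<close> against the
  first contour with the second one hidden in \<open>\<psi>\<close>, then \<open>v\<close> against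
  the second contour.\<close>

lemma laplace_inverse_Mellin_product:
  fixes A D :: "real \<Rightarrow> complex"
  assumes A: "integrable lborel A" and D: "integrable lborel D"
    and pos: "0 < 1 + \<sigma> + \<tau>" and XY: "0 < X" "0 < Y"
  shows "(\<integral>v. indicator {0<..} v *\<^sub>R (of_real (exp (- v)) *
      (\<integral>u. A u * of_real (X * v) powr Complex \<sigma> u \<partial>lborel) *
      (\<integral>w. D w * of_real (Y * v) powr Complex \<tau> w \<partial>lborel)) \<partial>lborel) =
    (\<integral>u. (\<integral>w. Gamma (1 + Complex \<sigma> u + Complex \<tau> w) * A u * D w *
      of_real X powr Complex \<sigma> u * of_real Y powr Complex \<tau> w \<partial>lborel) \<partial>lborel)"
proof -
  have [measurable]: "A \<in> borel_measurable borel" "D \<in> borel_measurable borel"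
    "Complex c \<in> borel_measurable borel" for c
    using A D by (auto dest: borel_measurable_integrable
      intro!: borel_measurable_continuous_onI continuous_intros)
  define \<psi> where "\<psi> v = (\<integral>w. D w * of_real (Y * v) powr Complex \<tau> w \<partial>lborel)" for v
  have [measurable]: "\<psi> \<in> borel_measurable borel"
    unfolding \<psi>_def by measurable
  define F where "F v u = indicator {0<..} v *\<^sub>R (of_real (exp (- v)) *
    (A u * of_real (X * v) powr Complex \<sigma> u) * \<psi> v)" for v u
  \<comment> \<open>With the L1 norm of \<open>D\<close>, |\<psi> v| is at most
    \<open>N * (Y * v) powr \<tau>\<close>. Together with the power of \<open>v\<close> from the
    first contour this leaves \<open>v powr (\<sigma> + \<tau>)\<close>, integrable at 0 by
    \<open>pos\<close>.\<close>
  define N where "N = (\<integral>w. norm (D w) \<partial>lborel)"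
  have "(\<integral>v. (\<integral>u. F v u \<partial>lborel) \<partial>lborel) = (\<integral>u. (\<integral>v. F v u \<partial>lborel) \<partial>lborel)"
  proof (rule Fubini_product_bound(2))
    show "case_prod F \<in> borel_measurable (lborel \<Otimes>\<^sub>M lborel)"
      unfolding F_def by measurable
    show "integrable lborel (\<lambda>v. indicator {0<..} v *\<^sub>R (exp (- v) * v powr ((1 + \<sigma> + \<tau>) - 1)))"
      using has_bochner_integral_Gamma_real[OF pos] by (simp add: has_bochner_integral_iff)
    show "integrable lborel (\<lambda>u. X powr \<sigma> * Y powr \<tau> * N * norm (A u))"
      using A by simp
    show "norm (F v u) \<le> indicator {0<..} v *\<^sub>R (exp (- v) * v powr ((1 + \<sigma> + \<tau>) - 1)) *
        (X powr \<sigma> * Y powr \<tau> * N * norm (A u))" for v u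
    proof (cases "0 < v")
      case True
      have "norm (\<psi> v) \<le> (\<integral>w. norm (D w * of_real (Y * v) powr Complex \<tau> w) \<partial>lborel)"
        unfolding \<psi>_def by (rule integral_norm_bound)
      also have "\<dots> = (Y * v) powr \<tau> * N"
        using True XY by (simp add: norm_mult norm_of_real_powr N_def mult.commute del: of_real_mult)
      finally have \<psi>: "norm (\<psi> v) \<le> (Y * v) powr \<tau> * N" .
      have "norm (F v u) = exp (- v) * (norm (A u) * (X * v) powr \<sigma>) * norm (\<psi> v)"
        using True XY by (simp add: F_def norm_mult norm_of_real_powr del: of_real_mult)
      also have "\<dots> \<le> exp (- v) * (norm (A u) * (X * v) powr \<sigma>) * ((Y * v) powr \<tau> * N)"
        using \<psi> by (intro mult_left_mono) auto
      also have "\<dots> = exp (- v) * v powr (\<sigma> + \<tau>) * (X powr \<sigma> * Y powr \<tau> * N * norm (A u))"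
        using True XY by (simp add: powr_mult powr_add mult_ac)
      finally show ?thesis using True by simp
    qed (simp add: F_def)
  qed
  moreover have "(\<integral>u. F v u \<partial>lborel) = indicator {0<..} v *\<^sub>R (of_real (exp (- v)) *
      (\<integral>u. A u * of_real (X * v) powr Complex \<sigma> u \<partial>lborel) * \<psi> v)" for v
    unfolding F_def by simp
  moreover have "(\<integral>v. F v u \<partial>lborel) = (\<integral>w. Gamma (1 + Complex \<sigma> u + Complex \<tau> w) * A u * D w *
      of_real X powr Complex \<sigma> u * of_real Y powr Complex \<tau> w \<partial>lborel)" for u
  proof -
    let ?s = "Complex \<sigma> u"
    have F_eq: "F v u = (A u * of_real X powr ?s) *
        (indicator {0<..} v *\<^sub>R (of_real (exp (- v)) * of_real v powr ?s * \<psi> v))" for v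
      using XY by (cases "0 < v") (simp_all add: F_def of_real_mult_powr mult_ac del: of_real_mult)
    have "(\<integral>v. F v u \<partial>lborel) = (A u * of_real X powr ?s) *
        (\<integral>v. indicator {0<..} v *\<^sub>R (of_real (exp (- v)) * of_real v powr ?s * \<psi> v) \<partial>lborel)"
      unfolding F_eq by (simp only: mult_scaleR_right[symmetric] integral_mult_right_zero)
    also have "(\<integral>v. indicator {0<..} v *\<^sub>R (of_real (exp (- v)) * of_real v powr ?s * \<psi> v) \<partial>lborel) =
        (\<integral>w. D w * of_real Y powr Complex \<tau> w * Gamma (1 + ?s + Complex \<tau> w) \<partial>lborel)"
      unfolding \<psi>_def using pos XY by (intro laplace_inverse_Mellin D) auto
    also have "(A u * of_real X powr ?s) * \<dots> = (\<integral>w. (A u * of_real X powr ?s) *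
        (D w * of_real Y powr Complex \<tau> w * Gamma (1 + ?s + Complex \<tau> w)) \<partial>lborel)"
      by simp
    finally show ?thesis by (simp add: mult_ac)
  qed
  ultimately show ?thesis
    by (simp add: \<psi>_def)
qed

text \<open>Euler's integral under the substitution \<open>v = p / y\<close>, whose Jacobian has
  modulus \<open>p / y\<^sup>2\<close>. The substitution theorem concerns absolute integrability for
  the completed measure, hence the passage from \<open>lborel\<close> and back.\<close>

lemma has_bochner_integral_inverse_Gamma:
  assumes z: "0 < Re z" and p: "0 < p"
  shows "has_bochner_integral lborel
    (\<lambda>y. indicator {0<..} y *\<^sub>R (of_real (exp (- (p / y)) / y) * of_real y powr - z))
    (of_real p powr - z * Gamma z)"
proof -
  define f where "f v = of_real (exp (- v)) * complex_of_real v powr (z - 1)" for v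
  define g where "g y = of_real (exp (- (p / y)) / y) * complex_of_real y powr - z" for y
  have f: "f absolutely_integrable_on {0<..} \<and> integral {0<..} f = Gamma z"
  proof
    have int: "set_integrable lborel {0<..} f"
      using has_bochner_integral_Gamma[OF z]
      by (simp add: set_integrable_def has_bochner_integral_iff f_def)
    then show "f absolutely_integrable_on {0<..}"
      unfolding set_integrable_def by (rule integrable_completion[THEN iffD2, rotated]) (use int in \<open>auto simp: set_integrable_def\<close>)
    show "integral {0<..} f = Gamma z"
      using has_bochner_integral_Gamma[OF z] set_borel_integral_eq_integral(2)[OF int]
      by (simp add: set_lebesgue_integral_def has_bochner_integral_iff f_def)
  qed
  have img: "(\<lambda>y. p / y) ` {0<..} = {0<..}"
  proof (intro equalityI subsetI)
    fix v :: real assume "v \<in> {0<..}"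
    then have "v = p / (p / v)" "p / v \<in> {0<..}" using p by auto
    then show "v \<in> (\<lambda>y. p / y) ` {0<..}" by blast
  qed (use p in auto)
  have subst: "(\<lambda>y. \<bar>- (p / y\<^sup>2)\<bar> *\<^sub>R f (p / y)) absolutely_integrable_on {0<..} \<and>
      integral {0<..} (\<lambda>y. \<bar>- (p / y\<^sup>2)\<bar> *\<^sub>R f (p / y)) = Gamma z"
  proof (subst has_absolute_integral_change_of_variables_real)
    show "((\<lambda>y. p / y) has_field_derivative - (p / y\<^sup>2)) (at y within {0<..})" if "y \<in> {0<..}" for y
      using that by (auto intro!: derivative_eq_intros simp: power2_eq_square)
    show "inj_on (\<lambda>y. p / y) {0<..}" using p by (auto simp: inj_on_def)
  qed (use f img in auto)
  have eq: "\<bar>- (p / y\<^sup>2)\<bar> *\<^sub>R f (p / y) = of_real p powr z * g y" if "y \<in> {0<..}" for y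
  proof -
    have y: "0 < y" using that by simp
    have "of_real (p / y) powr (z - 1) = of_real p powr (z - 1) * of_real (inverse y) powr (z - 1)"
      using of_real_mult_powr[of p "inverse y" "z - 1"] p y by (simp add: divide_inverse)
    also have "of_real (inverse y) powr (z - 1) = of_real y powr - z * of_real y"
      using y Ln_of_real[of "inverse y"]
      by (simp add: powr_def Ln_of_real ln_inverse algebra_simps exp_add exp_diff exp_minus exp_of_real divide_inverse)
    also have "of_real p powr (z - 1) = of_real p powr z / of_real p"
      using p by (simp add: powr_diff)
    finally show ?thesis
      using p y by (simp add: f_def g_def scaleR_conv_of_real power2_eq_square field_simps)
  qed
  have "set_integrable lebesgue {0<..} (\<lambda>y. \<bar>- (p / y\<^sup>2)\<bar> *\<^sub>R f (p / y)) =
      set_integrable lebesgue {0<..} (\<lambda>y. of_real p powr z * g y)"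
    by (rule set_integrable_cong[OF refl refl eq])
  moreover have "integral {0<..} (\<lambda>y. \<bar>- (p / y\<^sup>2)\<bar> *\<^sub>R f (p / y)) =
      integral {0<..} (\<lambda>y. of_real p powr z * g y)"
    by (rule Henstock_Kurzweil_Integration.integral_cong[OF eq])
  ultimately have "(\<lambda>y. of_real p powr z * g y) absolutely_integrable_on {0<..} \<and>
      integral {0<..} (\<lambda>y. of_real p powr z * g y) = Gamma z"
    using subst by (simp only:)
  moreover have "of_real p powr z \<noteq> (0::complex)" using p by simp
  ultimately have g: "g absolutely_integrable_on {0<..}" "of_real p powr z * integral {0<..} g = Gamma z"
    by auto
  have int: "set_integrable lborel {0<..} g"
    using g(1) unfolding set_integrable_def g_def by (subst (asm) integrable_completion) auto
  moreover have "integral {0<..} g = of_real p powr - z * Gamma z"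
    using g(2) p by (simp add: powr_minus field_simps)
  ultimately show ?thesis
    using set_borel_integral_eq_integral(2)[OF int]
    by (simp add: has_bochner_integral_iff set_integrable_def set_lebesgue_integral_def g_def)
qed

subsection \<open>The inverse exponential moment of the optical hop\<close>

lemma of_real_powr_powr:
  "0 < x \<Longrightarrow> of_real (x powr e) powr z = of_real x powr (of_real e * z :: complex)"
  by (simp add: powr_def Ln_of_real ln_powr powr_gt_zero exp_of_real mult_ac)

text \<open>On the contour the integrand in \<open>y\<close> has size
  \<open>exp (- (p / y)) * y powr (\<tau> - 1)\<close>: the exponential controls it at 0, and
  \<open>\<tau> < 0\<close> at infinity. So every line with negative real part can serve.\<close>

lemma inverse_exp_moment_meijer_G:
  fixes a b d B \<mu> r p \<tau> :: real
  assumes pos: "0 < a" "0 < b" "0 < d" "0 < B" "0 < \<mu>" "0 < r" "0 < p" and \<tau>: "\<tau> < 0"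
  defines "G \<equiv> \<lambda>y. meijer_G 3 0 [of_real (a + 1)] [of_real a, of_real b, of_real d]
      (B * (y / \<mu>) powr (1 / r))"
  shows "integrable lborel (\<lambda>y. indicator {0<..} y *\<^sub>R (of_real (exp (- (p / y)) / y) * G y))"
    and "(\<integral>y. indicator {0<..} y *\<^sub>R (of_real (exp (- (p / y)) / y) * G y) \<partial>lborel) =
      r / (2 * pi) * (\<integral>w. turbulence_kernel a b d (- of_real r * Complex \<tau> w) *
        Gamma (- Complex \<tau> w) * of_real (p * B powr r / \<mu>) powr Complex \<tau> w \<partial>lborel)"
proof -
  \<comment> \<open>The real part of \<open>s = - r * t\<close> when \<open>Re t = \<tau>\<close>.
    It is positive, hence to the right of all poles, the parameters \<open>a\<close>,
    \<open>b\<close>, \<open>d\<close> being positive.\<close>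
  define c where "c = - r * \<tau>"
  have c: "0 < c" using pos \<tau> by (simp add: c_def mult_pos_neg)
  define k where "k = B * \<mu> powr - (1 / r)"
  have k: "0 < k" using pos by (simp add: k_def)
  define T where "T u = turbulence_kernel a b d (Complex c u)" for u
  have T: "integrable lborel T"
    unfolding T_def using c pos by (intro turbulence_kernel_integrable) auto
  have [measurable]: "T \<in> borel_measurable borel" "Complex c \<in> borel_measurable borel"
    using T by (auto dest: borel_measurable_integrable
      intro!: borel_measurable_continuous_onI continuous_intros)
  define F where "F y u = indicator {0<..} y *\<^sub>R (of_real (exp (- (p / y)) / y) *
    (T u * of_real (k * y powr (1 / r)) powr - Complex c u))" for y u
  have kr: "k powr r = B powr r / \<mu>"
  proof -
    have "k powr r = B powr r * (\<mu> powr - (1 / r)) powr r"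
      unfolding k_def by (rule powr_mult)
    also have "(\<mu> powr - (1 / r)) powr r = \<mu> powr - 1"
      unfolding powr_powr using pos by simp
    finally show ?thesis using pos by (simp add: powr_minus divide_inverse)
  qed
  have G_eq: "indicator {0<..} y *\<^sub>R (of_real (exp (- (p / y)) / y) * G y) =
      1 / (2 * pi) * (\<integral>u. F y u \<partial>lborel)" for y
  proof (cases "0 < y")
    case True
    have "B * (y / \<mu>) powr (1 / r) = k * y powr (1 / r)"
      using True pos by (simp add: k_def powr_divide powr_minus_divide)
    then have "G y = 1 / (2 * pi) * (\<integral>u. T u * of_real (k * y powr (1 / r)) powr - Complex c u \<partial>lborel)"
      unfolding G_def T_def using meijer_G_eq_integral[of a c b d "k * y powr (1 / r)"] pos c k True by simp
    then show ?thesis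
      using True by (simp add: F_def)
  qed (simp add: F_def)
  have meas: "case_prod F \<in> borel_measurable (lborel \<Otimes>\<^sub>M lborel)"
    unfolding F_def by measurable
  let ?f = "\<lambda>y. indicator {0<..} y *\<^sub>R (exp (- (p / y)) / y * y powr \<tau>)"
  have f: "integrable lborel ?f"
  proof -
    have "integrable lborel (\<lambda>y. norm (indicator {0<..} y *\<^sub>R
        (of_real (exp (- (p / y)) / y) * complex_of_real y powr - of_real (- \<tau>))))"
      using has_bochner_integral_inverse_Gamma[of "of_real (- \<tau>)" p] \<tau> pos
      by (intro integrable_norm) (simp add: has_bochner_integral_iff)
    also have "(\<lambda>y. norm (indicator {0<..} y *\<^sub>R
        (of_real (exp (- (p / y)) / y) * complex_of_real y powr - of_real (- \<tau>)))) = ?f"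
      by (auto simp: indicator_def norm_mult norm_divide norm_of_real_powr)
    finally show ?thesis .
  qed
  have g: "integrable lborel (\<lambda>u. k powr - c * norm (T u))"
    using T by simp
  have le: "norm (F y u) \<le> ?f y * (k powr - c * norm (T u))" for y u
  proof (cases "0 < y")
    case True
    have "(y powr (1 / r)) powr - c = y powr \<tau>"
      using pos by (simp add: powr_powr c_def)
    then have "norm (F y u) = exp (- (p / y)) / y * (norm (T u) * (k powr - c * y powr \<tau>))"
      using True k by (simp add: F_def norm_mult norm_divide norm_of_real_powr powr_mult del: of_real_mult)
    then show ?thesis using True by (simp add: mult_ac)
  qed (simp add: F_def)
  note Fubini = Fubini_product_bound[OF meas f g le]
  show "integrable lborel (\<lambda>y. indicator {0<..} y *\<^sub>R (of_real (exp (- (p / y)) / y) * G y))"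
    unfolding G_eq using Fubini(3) by (intro integrable_mult_right)
  define H where "H t = turbulence_kernel a b d (- of_real r * t) *
        Gamma (- t) * of_real (p * B powr r / \<mu>) powr t" for t
  \<comment> \<open>The imaginary part \<open>- (u / r)\<close> solves
    \<open>Complex c u = - r * t\<close>.\<close>
  have inner: "(\<integral>y. F y u \<partial>lborel) = H (Complex \<tau> (- (u / r)))" for u
  proof -
    define t where "t = Complex \<tau> (- (u / r))"
    have s: "Complex c u = - of_real r * t"
      using pos by (simp add: t_def c_def complex_eq_iff)
    have F_eq: "F y u = (T u * of_real k powr (of_real r * t)) *
        (indicator {0<..} y *\<^sub>R (of_real (exp (- (p / y)) / y) * of_real y powr - (- t)))" for y
    proof (cases "0 < y")
      case True
      have "of_real (k * y powr (1 / r)) powr - Complex c u =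
          of_real k powr (of_real r * t) * of_real y powr t"
        using True k pos by (subst of_real_mult_powr) (auto simp: s of_real_powr_powr)
      then show ?thesis using True by (simp add: F_def mult_ac)
    qed (simp add: F_def)
    have "(\<integral>y. F y u \<partial>lborel) = (T u * of_real k powr (of_real r * t)) *
        (\<integral>y. indicator {0<..} y *\<^sub>R (of_real (exp (- (p / y)) / y) * of_real y powr - (- t)) \<partial>lborel)"
      unfolding F_eq by (rule integral_mult_right_zero)
    also have "(\<integral>y. indicator {0<..} y *\<^sub>R (of_real (exp (- (p / y)) / y) * of_real y powr - (- t)) \<partial>lborel)
        = of_real p powr t * Gamma (- t)"
      using has_bochner_integral_inverse_Gamma[of "- t" p] \<tau> pos
      by (simp add: has_bochner_integral_iff t_def)
    also have "of_real k powr (of_real r * t) = of_real (B powr r / \<mu>) powr t"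
      using k kr by (simp flip: of_real_powr_powr)
    also have "(T u * of_real (B powr r / \<mu>) powr t) * (of_real p powr t * Gamma (- t)) = H t"
      using pos of_real_mult_powr[of p "B powr r / \<mu>" t] by (simp add: H_def T_def s mult_ac)
    finally show ?thesis by (simp add: t_def)
  qed
  have "(\<integral>y. indicator {0<..} y *\<^sub>R (of_real (exp (- (p / y)) / y) * G y) \<partial>lborel) =
      1 / (2 * pi) * (\<integral>y. (\<integral>u. F y u \<partial>lborel) \<partial>lborel)"
    unfolding G_eq by (rule integral_mult_right_zero)
  also have "(\<integral>y. (\<integral>u. F y u \<partial>lborel) \<partial>lborel) = (\<integral>u. H (Complex \<tau> (- (u / r))) \<partial>lborel)"
    unfolding Fubini(2) inner ..
  \<comment> \<open>The Jacobian of \<open>u = - r * w\<close> enters through its modulus, so the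
    reversed orientation leaves the factor \<open>r\<close>.\<close>
  also have "\<dots> = r * (\<integral>w. H (Complex \<tau> w) \<partial>lborel)"
    using lborel_integral_real_affine[of "- r" "\<lambda>u. H (Complex \<tau> (- (u / r)))" 0] pos
    by (simp add: scaleR_conv_of_real)
  finally show "(\<integral>y. indicator {0<..} y *\<^sub>R (of_real (exp (- (p / y)) / y) * G y) \<partial>lborel) =
      r / (2 * pi) * (\<integral>w. turbulence_kernel a b d (- of_real r * Complex \<tau> w) *
        Gamma (- Complex \<tau> w) * of_real (p * B powr r / \<mu>) powr Complex \<tau> w \<partial>lborel)"
    by (simp add: H_def)
qed

section \<open>From the G-kernel to the one-variable kernel of the H-function\<close>

definition capacity_kernel :: "nat \<Rightarrow> real \<Rightarrow> real \<Rightarrow> nat \<Rightarrow> complex \<Rightarrow> complex" where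
  "capacity_kernel r \<xi> \<alpha> n t =
    (\<Prod>a\<leftarrow>tau4 r \<xi> \<alpha> n. Gamma (of_real a - t)) / (\<Prod>a\<leftarrow>tau5 r \<xi>. Gamma (of_real a - t))"

text \<open>No duplication occurs for \<open>r = 1\<close>: the only entry of \<open>tau5\<close>
  cancels against the first entry of \<open>tau4\<close> up to
  \<open>1 / (\<xi>\<^sup>2 - t)\<close>, and the final entry 0 of \<open>tau4\<close> gives
  \<open>Gamma (- t)\<close>.\<close>

lemma capacity_kernel_1:
  assumes "0 < \<xi>" "Re t < 0"
  shows "capacity_kernel 1 \<xi> \<alpha> n t = turbulence_kernel (\<xi>\<^sup>2) \<alpha> (real n) (- t) * Gamma (- t)"
proof -
  have Re: "0 < Re (of_real (\<xi>\<^sup>2) - t)"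
    using order.strict_trans2[OF assms(2) zero_le_power2[of \<xi>]] by simp
  have "Gamma ((of_real (\<xi>\<^sup>2) - t) + 1) = (of_real (\<xi>\<^sup>2) - t) * Gamma (of_real (\<xi>\<^sup>2) - t)"
    using Re by (rule Gamma_plus1_complex)
  then have "Gamma (of_real (\<xi>\<^sup>2 + 1) - t) = (of_real (\<xi>\<^sup>2) - t) * Gamma (of_real (\<xi>\<^sup>2) - t)"
    by (simp add: algebra_simps)
  moreover have "Gamma (of_real (\<xi>\<^sup>2) - t) \<noteq> 0"
    using notin_nonpos_Ints_complex[OF Re] by (simp add: Gamma_eq_zero_iff)
  ultimately show ?thesis
    by (simp add: capacity_kernel_def tau4_def tau5_def Delta_def turbulence_kernel_def)
qed

text \<open>Legendre duplication at \<open>z = x / 2 - t\<close>. Its factor 2^(1 - 2z) is separated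
  into a constant and \<open>2 powr (2 * t)\<close>, so that the powers coming from several pairs
  can be collected.\<close>

lemma Gamma_duplication_half:
  fixes x :: real and t :: complex
  assumes "Re t < x / 2"
  shows "Gamma (of_real (x / 2) - t) * Gamma (of_real ((x + 1) / 2) - t) =
    2 * of_real (2 powr - x) * of_real 2 powr (2 * t) * of_real (sqrt pi) * Gamma (of_real x - 2 * t)"
proof -
  define z where "z = of_real (x / 2) - t"
  have "0 < Re z" using assms by (simp add: z_def)
  then have "Gamma z * Gamma (z + 1 / 2) = exp ((1 - 2 * z) * of_real (ln 2)) * of_real (sqrt pi) * Gamma (2 * z)"
    by (intro Gamma_legendre_duplication notin_nonpos_Ints_complex) auto
  moreover have "z + 1 / 2 = of_real ((x + 1) / 2) - t" "2 * z = of_real x - 2 * t"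
    by (auto simp: z_def field_simps)
  moreover have "exp ((1 - 2 * z) * of_real (ln 2)) = 2 * of_real (2 powr - x) * of_real 2 powr (2 * t)"
  proof -
    have "(1 - 2 * z) * of_real (ln 2) = of_real (ln 2) + of_real (- x * ln 2) + 2 * t * of_real (ln 2)"
      by (simp add: z_def algebra_simps)
    moreover have "exp (of_real (ln 2)) = (2 :: complex)" "exp (of_real (- x * ln 2)) = complex_of_real (2 powr - x)"
      by (simp_all only: exp_of_real) (simp_all add: powr_def)
    moreover have "exp (2 * t * of_real (ln 2)) = of_real 2 powr (2 * t)"
      using Ln_of_real[of 2] by (simp add: powr_def)
    ultimately show ?thesis by (simp only: exp_add)
  qed
  ultimately show ?thesis unfolding z_def[symmetric] by (simp only: mult.assoc)
qed

text \<open>Three pairs in the numerator and one in the denominator leave two net factors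
  \<open>Q\<close>, and \<open>Q * Q\<close> is pi times 16^t. The ratio of the \<open>\<xi>\<close>
  pairs is \<open>2 / (a - 2 * t)\<close>; the constants 2^(-\<alpha>) and 2^(-n) of the other two
  pairs are what the prefactor on the left removes.\<close>

lemma capacity_kernel_2:
  assumes "0 < \<xi>" "0 < \<alpha>" "Re t < 0"
  shows "of_real (2 powr (\<alpha> + real n - 1) / (2 * pi)) * capacity_kernel 2 \<xi> \<alpha> n t =
    2 * turbulence_kernel (\<xi>\<^sup>2) \<alpha> (real n) (- 2 * t) * Gamma (- t) * of_real 16 powr t"
proof -
  define a where "a = \<xi>\<^sup>2"
  have a: "0 < a" using assms by (simp add: a_def)
  define E where "E x = Gamma (of_real (x / 2) - t) * Gamma (of_real ((x + 1) / 2) - t)" for x :: real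
  define Q where "Q = complex_of_real 2 powr (2 * t) * of_real (sqrt pi)"
  have Q: "Q \<noteq> 0" by (simp add: Q_def)
  have E: "E x = 2 * of_real (2 powr - x) * Q * Gamma (of_real x - 2 * t)" if "0 \<le> x" for x
    using Gamma_duplication_half[of t x] that assms by (simp add: E_def Q_def)
  have kernel: "capacity_kernel 2 \<xi> \<alpha> n t = E a * E \<alpha> * E (real n) * Gamma (- t) / E (a + 1)"
    by (simp add: capacity_kernel_def tau4_def tau5_def Delta_def E_def a_def numeral_2_eq_2 mult_ac)
  have Re: "0 < Re (of_real a - 2 * t)" using a assms by simp
  have G1: "Gamma (of_real (a + 1) - 2 * t) = (of_real a - 2 * t) * Gamma (of_real a - 2 * t)"
    using Gamma_plus1_complex[OF Re] by (simp add: algebra_simps)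
  have nz: "Gamma (of_real a - 2 * t) \<noteq> 0" "of_real a - 2 * t \<noteq> 0"
    using notin_nonpos_Ints_complex[OF Re] Re by (auto simp: Gamma_eq_zero_iff)
  have "E a / E (a + 1) = 2 / (of_real a - 2 * t)"
  proof -
    have "2 * 2 powr - (a + 1) = 2 powr - a" by (simp add: powr_diff)
    then have half: "2 * complex_of_real (2 powr - (a + 1)) = of_real (2 powr - a)"
      by (metis of_real_mult of_real_numeral)
    have "E (a + 1) = 2 * of_real (2 powr - (a + 1)) * Q * Gamma (of_real (a + 1) - 2 * t)"
      using a by (intro E) simp
    then have "E (a + 1) = of_real (2 powr - a) * Q * ((of_real a - 2 * t) * Gamma (of_real a - 2 * t))"
      unfolding half G1 .
    then show ?thesis
      using E[of a] a nz Q by simp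
  qed
  moreover have "Q * Q = of_real pi * of_real 16 powr t"
  proof -
    have "of_real 2 powr (2 * t) * of_real 2 powr (2 * t) = complex_of_real (2 powr 4) powr t"
      by (subst of_real_powr_powr) (simp_all add: field_simps flip: powr_add)
    moreover have "complex_of_real (sqrt pi) * of_real (sqrt pi) = of_real pi"
      by (simp flip: of_real_mult)
    ultimately show ?thesis by (simp add: Q_def mult_ac)
  qed
  moreover have "of_real (2 powr (\<alpha> + real n - 1) / (2 * pi)) *
      (4 * of_real (2 powr - \<alpha>) * of_real (2 powr - real n)) = complex_of_real (1 / pi)"
  proof -
    have "2 powr (\<alpha> + real n - 1) / (2 * pi) * (4 * 2 powr - \<alpha> * 2 powr - real n) = 1 / pi"
      by (simp add: powr_add powr_diff powr_minus field_simps)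
    then have "complex_of_real (2 powr (\<alpha> + real n - 1) / (2 * pi) * (4 * 2 powr - \<alpha> * 2 powr - real n)) = of_real (1 / pi)"
      by (rule arg_cong)
    then show ?thesis by simp
  qed
  moreover have "of_real (2 powr (\<alpha> + real n - 1) / (2 * pi)) * capacity_kernel 2 \<xi> \<alpha> n t =
      (E a / E (a + 1)) * (Q * Q) * (of_real (2 powr (\<alpha> + real n - 1) / (2 * pi)) *
      (4 * of_real (2 powr - \<alpha>) * of_real (2 powr - real n))) *
      (Gamma (of_real \<alpha> - 2 * t) * Gamma (of_real (real n) - 2 * t)) * Gamma (- t)"
    using assms by (simp add: kernel E[of \<alpha>] E[of "real n"] mult_ac)
  ultimately show ?thesis
    by (simp add: turbulence_kernel_def a_def)
qed

text \<open>The base \<open>real r ^ (2 * r)\<close> equals 1 or 16 and unifies the two cases. It is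
  the origin of the division by r^2 in \<open>(B / (real r)\<^sup>2) ^ r\<close>, just as the
  prefactor is the origin of r^(\<alpha>+n-1) and (2 pi)^(r-1) in the capacity formula.\<close>

lemma capacity_kernel_eq:
  assumes "r = 1 \<or> r = 2" "0 < \<xi>" "0 < \<alpha>" "Re t < 0"
  shows "of_real (real r powr (\<alpha> + real n - 1) / (2 * pi) ^ (r - 1)) * capacity_kernel r \<xi> \<alpha> n t =
    of_nat r * turbulence_kernel (\<xi>\<^sup>2) \<alpha> (real n) (- of_real (real r) * t) * Gamma (- t) *
      of_real (real r ^ (2 * r)) powr t"
  using assms capacity_kernel_1[of \<xi> t \<alpha> n] capacity_kernel_2[of \<xi> \<alpha> t n] by auto

subsection \<open>The bivariate H-function as a real integral\<close>

text \<open>Bounding the Gamma factors one by one fails because of the growing reciprocals. By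
  \<open>capacity_kernel_eq\<close> the kernel is an integrable turbulence kernel, on the line
  scaled by \<open>- r\<close>, times the bounded function \<open>m\<close>.\<close>

lemma capacity_kernel_integrable:
  assumes r: "r = 1 \<or> r = 2" and pos: "0 < \<xi>" "0 < \<alpha>" "0 < n" and \<tau>: "\<tau> < 0"
  shows "integrable lborel (\<lambda>w. capacity_kernel r \<xi> \<alpha> n (Complex \<tau> w))"
proof -
  define K where "K = real r powr (\<alpha> + real n - 1) / (2 * pi) ^ (r - 1)"
  have K: "K \<noteq> 0" using r by (auto simp: K_def)
  define R where "R = real r ^ (2 * r)"
  have R: "0 < R" using r by (auto simp: R_def)
  have r0: "0 < real r" using r by auto
  define T where "T w = turbulence_kernel (\<xi>\<^sup>2) \<alpha> (real n) (- of_real (real r) * Complex \<tau> w)" for w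
  have T: "integrable lborel T"
  proof -
    define c where "c = - real r * \<tau>"
    have c: "0 < c" using r0 \<tau> by (simp add: c_def mult_pos_neg)
    have "0 < \<xi>\<^sup>2" using pos by simp
    then have "integrable lborel (\<lambda>u. turbulence_kernel (\<xi>\<^sup>2) \<alpha> (real n) (Complex c u))"
      using c pos by (intro turbulence_kernel_integrable; linarith)
    then have "integrable lborel (\<lambda>w. turbulence_kernel (\<xi>\<^sup>2) \<alpha> (real n) (Complex c (0 + (- real r) * w)))"
      using r0 by (intro lborel_integrable_real_affine) auto
    moreover have "Complex c (0 + (- real r) * w) = - of_real (real r) * Complex \<tau> w" for w
      by (simp add: c_def complex_eq_iff)
    ultimately show ?thesis by (simp add: T_def[abs_def])
  qed
  define m where "m w = Gamma (- Complex \<tau> w) * of_real R powr Complex \<tau> w" for w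
  have [measurable]: "T \<in> borel_measurable borel"
    using T by (auto dest: borel_measurable_integrable)
  have [measurable]: "m \<in> borel_measurable borel"
  proof -
    have "continuous_on UNIV (\<lambda>w. Gamma (- Complex \<tau> w))"
      by (rule continuous_on_compose2[OF continuous_on_Gamma[of "{z. 0 < Re z}"]])
         (use \<tau> in \<open>auto intro!: continuous_intros dest: notin_nonpos_Ints_complex\<close>)
    moreover have "continuous_on UNIV (Complex \<tau>)"
      by (intro continuous_intros)
    ultimately show ?thesis
      unfolding m_def by (intro borel_measurable_times borel_measurable_of_real_powr
        borel_measurable_continuous_onI) auto
  qed
  have m: "norm (m w) \<le> Gamma (- \<tau>) * R powr \<tau>" for w
    using norm_Gamma_le_Gamma_Re[of "- Complex \<tau> w"] \<tau> R
    by (simp add: m_def norm_mult norm_of_real_powr mult_right_mono)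
  have "integrable lborel (\<lambda>w. T w * m w)"
  proof (rule Bochner_Integration.integrable_bound)
    show "integrable lborel (\<lambda>w. (Gamma (- \<tau>) * R powr \<tau>) *\<^sub>R T w)"
      using T by simp
    have "norm (T w * m w) \<le> norm ((Gamma (- \<tau>) * R powr \<tau>) *\<^sub>R T w)" for w
    proof -
      have "norm (T w * m w) \<le> norm (T w) * (Gamma (- \<tau>) * R powr \<tau>)"
        unfolding norm_mult by (intro mult_left_mono m) simp
      also have "\<dots> \<le> norm ((Gamma (- \<tau>) * R powr \<tau>) *\<^sub>R T w)"
        unfolding norm_scaleR by (subst mult.commute) (intro mult_right_mono abs_ge_self norm_ge_zero)
      finally show ?thesis .
    qed
    then show "AE w in lborel. norm (T w * m w) \<le> norm ((Gamma (- \<tau>) * R powr \<tau>) *\<^sub>R T w)"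
      by simp
  qed simp
  then have "integrable lborel (\<lambda>w. of_nat r / of_real K * (T w * m w))"
    by (rule integrable_mult_right)
  moreover have "capacity_kernel r \<xi> \<alpha> n (Complex \<tau> w) = of_nat r / of_real K * (T w * m w)" for w
    using capacity_kernel_eq[OF r pos(1,2), of "Complex \<tau> w" n, folded K_def R_def] \<tau> K
    by (simp add: T_def m_def field_simps)
  ultimately show ?thesis by simp
qed

lemma inverse_exp_moment_capacity_kernel:
  fixes \<xi> \<alpha> B \<mu> p \<tau> :: real
  assumes r: "r = 1 \<or> r = 2"
    and pos: "0 < \<xi>" "0 < \<alpha>" "0 < n" "0 < B" "0 < \<mu>" "0 < p" and \<tau>: "\<tau> < 0"
  defines "G \<equiv> \<lambda>y. meijer_G 3 0 [of_real (\<xi>\<^sup>2 + 1)] [of_real (\<xi>\<^sup>2), of_real \<alpha>, of_nat n]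
      (B * (y / \<mu>) powr (1 / real r))"
  shows "integrable lborel (\<lambda>y. indicator {0<..} y *\<^sub>R (of_real (exp (- (p / y)) / y) * G y))"
    and "(\<integral>y. indicator {0<..} y *\<^sub>R (of_real (exp (- (p / y)) / y) * G y) \<partial>lborel) =
      of_real (real r powr (\<alpha> + real n - 1) / (2 * pi) ^ (r - 1)) / (2 * pi) *
      (\<integral>w. capacity_kernel r \<xi> \<alpha> n (Complex \<tau> w) *
        of_real (p * (B / (real r)\<^sup>2) ^ r / \<mu>) powr Complex \<tau> w \<partial>lborel)"
proof -
  have r0: "0 < real r" using r by auto
  have \<xi>: "0 < \<xi>\<^sup>2" using pos by simp
  define K where "K = real r powr (\<alpha> + real n - 1) / (2 * pi) ^ (r - 1)"
  have n: "complex_of_real (real n) = of_nat n" by simp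
  note moment = inverse_exp_moment_meijer_G[of "\<xi>\<^sup>2" \<alpha> "real n" B \<mu> "real r" p \<tau>, unfolded n]
  show "integrable lborel (\<lambda>y. indicator {0<..} y *\<^sub>R (of_real (exp (- (p / y)) / y) * G y))"
    unfolding G_def using moment(1) \<xi> r0 pos \<tau> by simp
  define Z where "Z = p * (B / (real r)\<^sup>2) ^ r / \<mu>"
  have Z: "0 < Z" using pos r0 by (simp add: Z_def)
  have "((real r)\<^sup>2) ^ r = real r ^ (2 * r)"
    by (rule power_mult[symmetric])
  \<comment> \<open>The power of \<open>r\<close> freed here is absorbed by
    \<open>capacity_kernel_eq\<close>, and \<open>Z\<close> remains as argument.\<close>
  then have split: "p * B powr real r / \<mu> = real r ^ (2 * r) * Z"
    using r0 pos by (simp add: Z_def powr_realpow power_divide)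
  have eq: "real r / (2 * pi) * (turbulence_kernel (\<xi>\<^sup>2) \<alpha> (real n) (- of_real (real r) * t) *
        Gamma (- t) * of_real (p * B powr real r / \<mu>) powr t) =
      of_real K / (2 * pi) * (capacity_kernel r \<xi> \<alpha> n t * of_real Z powr t)" if "Re t < 0" for t
  proof -
    have "of_real (p * B powr real r / \<mu>) powr t =
        of_real (real r ^ (2 * r)) powr t * of_real Z powr t"
      unfolding split using r0 Z by (intro of_real_mult_powr) auto
    then show ?thesis
      using capacity_kernel_eq[OF r pos(1,2) that, of n, folded K_def]
      by (simp add: mult_ac)
  qed
  have "(\<integral>y. indicator {0<..} y *\<^sub>R (of_real (exp (- (p / y)) / y) * G y) \<partial>lborel) =
      (\<integral>w. real r / (2 * pi) * (turbulence_kernel (\<xi>\<^sup>2) \<alpha> (real n) (- of_real (real r) * Complex \<tau> w) *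
        Gamma (- Complex \<tau> w) * of_real (p * B powr real r / \<mu>) powr Complex \<tau> w) \<partial>lborel)"
    unfolding integral_mult_right_zero G_def using moment(2) \<xi> r0 pos \<tau> by simp
  also have "\<dots> = (\<integral>w. of_real K / (2 * pi) * (capacity_kernel r \<xi> \<alpha> n (Complex \<tau> w) *
      of_real Z powr Complex \<tau> w) \<partial>lborel)"
    using eq \<tau> by (intro Bochner_Integration.integral_cong refl) simp
  finally show "(\<integral>y. indicator {0<..} y *\<^sub>R (of_real (exp (- (p / y)) / y) * G y) \<partial>lborel) =
      of_real (real r powr (\<alpha> + real n - 1) / (2 * pi) ^ (r - 1)) / (2 * pi) *
      (\<integral>w. capacity_kernel r \<xi> \<alpha> n (Complex \<tau> w) *
        of_real (p * (B / (real r)\<^sup>2) ^ r / \<mu>) powr Complex \<tau> w \<partial>lborel)"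
    unfolding integral_mult_right_zero K_def Z_def .
qed

text \<open>The obtained \<open>\<tau>\<close> is the one chosen inside \<open>fox_H2\<close>; it
  does not depend on \<open>X\<close> and \<open>Y\<close>, so one value serves for all arguments.
  The companion \<open>\<sigma>\<close> disappears, since its contour integral is evaluated to
  \<open>2 * pi / (1 + X * v)\<close>.\<close>

lemma capacity_H_eq_laplace_integral:
  assumes r: "r = 1 \<or> r = 2" and pos: "0 < \<xi>" "0 < \<alpha>" "0 < n"
  obtains \<tau> where "\<tau> < 0"
    "\<And>X Y. 0 < X \<Longrightarrow> 0 < Y \<Longrightarrow> integrable lborel
      (\<lambda>v. indicator {0<..} v *\<^sub>R (of_real (exp (- v) / (1 + X * v)) *
        (1 / (2 * pi) * (\<integral>w. capacity_kernel r \<xi> \<alpha> n (Complex \<tau> w) *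
          of_real (Y * v) powr Complex \<tau> w \<partial>lborel))))"
    "\<And>X Y. 0 < X \<Longrightarrow> 0 < Y \<Longrightarrow> capacity_H r \<xi> \<alpha> n X Y =
      (\<integral>v. indicator {0<..} v *\<^sub>R (of_real (exp (- v) / (1 + X * v)) *
        (1 / (2 * pi) * (\<integral>w. capacity_kernel r \<xi> \<alpha> n (Complex \<tau> w) *
          of_real (Y * v) powr Complex \<tau> w \<partial>lborel))) \<partial>lborel)"
proof -
  obtain \<sigma> \<tau> where \<sigma>\<tau>: "- 1 < \<sigma>" "\<sigma> < 0" "\<tau> < 0" "- 1 < \<sigma> + \<tau>"
    and H: "\<And>x y. capacity_H r \<xi> \<alpha> n x y =
       1 / (2 * of_real pi * \<i>)\<^sup>2 *
       vline_integral \<sigma> (\<lambda>s. vline_integral \<tau> (\<lambda>t.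
         Gamma (1 + s + t) * (Gamma (- s) * Gamma (1 + s)) *
         ((\<Prod>a\<leftarrow>tau4 r \<xi> \<alpha> n. Gamma (of_real a - t)) / (\<Prod>a\<leftarrow>tau5 r \<xi>. Gamma (of_real a - t))) *
         of_real x powr s * of_real y powr t))"
    using capacity_H_eq[of \<xi> \<alpha> r n] pos by blast
  define A where "A u = Gamma (- Complex \<sigma> u) * Gamma (1 + Complex \<sigma> u)" for u
  define D where "D w = capacity_kernel r \<xi> \<alpha> n (Complex \<tau> w)" for w
  have A: "integrable lborel A"
    using inverse_Mellin_geometric(1)[OF \<sigma>\<tau>(1,2), of 1] by (simp add: A_def[abs_def])
  have D: "integrable lborel D"
    unfolding D_def by (rule capacity_kernel_integrable[OF r pos \<sigma>\<tau>(3)])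
  show thesis
  proof (rule that[OF \<sigma>\<tau>(3)])
    fix X Y :: real
    assume XY: "0 < X" "0 < Y"
    have [measurable]: "D \<in> borel_measurable borel" "Complex \<tau> \<in> borel_measurable borel"
      using D by (auto dest: borel_measurable_integrable
        intro!: borel_measurable_continuous_onI continuous_intros)
    define F where "F v = indicator {0<..} v *\<^sub>R (of_real (exp (- v) / (1 + X * v)) *
        (1 / (2 * pi) * (\<integral>w. D w * of_real (Y * v) powr Complex \<tau> w \<partial>lborel)))" for v
    have [measurable]: "F \<in> borel_measurable borel"
      unfolding F_def by measurable
    define N where "N = Y powr \<tau> * (\<integral>w. norm (D w) \<partial>lborel)"
    have "integrable lborel F"
    proof (rule Bochner_Integration.integrable_bound)
      \<comment> \<open>Convergence at 0 needs \<open>\<tau> > - 1\<close>, which follows from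
        \<open>\<sigma> + \<tau> > - 1\<close> and \<open>\<sigma> < 0\<close>.\<close>
      show "integrable lborel (\<lambda>v. N * (indicator {0<..} v *\<^sub>R (exp (- v) * v powr ((1 + \<tau>) - 1))))"
        using has_bochner_integral_Gamma_real[of "1 + \<tau>"] \<sigma>\<tau>
        by (intro integrable_mult_right) (simp add: has_bochner_integral_iff)
      have "norm (F v) \<le> N * (indicator {0<..} v *\<^sub>R (exp (- v) * v powr ((1 + \<tau>) - 1)))" for v
      proof (cases "0 < v")
        case True
        have "norm (\<integral>w. D w * of_real (Y * v) powr Complex \<tau> w \<partial>lborel) \<le>
            (\<integral>w. norm (D w * of_real (Y * v) powr Complex \<tau> w) \<partial>lborel)"
          by (rule integral_norm_bound)
        also have "\<dots> = N * v powr \<tau>"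
          using True XY by (simp add: norm_mult norm_of_real_powr powr_mult N_def mult_ac del: of_real_mult)
        finally have 1: "norm (\<integral>w. D w * of_real (Y * v) powr Complex \<tau> w \<partial>lborel) \<le> N * v powr \<tau>" .
        have "0 < X * v" using True XY by simp
        then have "1 / (1 + X * v) * (1 / (2 * pi)) \<le> 1 * 1"
          using pi_ge_two by (intro mult_mono) simp_all
        then have "1 / (1 + X * v) * (1 / (2 * pi)) * norm (\<integral>w. D w * of_real (Y * v) powr Complex \<tau> w \<partial>lborel) \<le>
            1 * (N * v powr \<tau>)"
          using 1 True XY by (intro mult_mono) auto
        then have "exp (- v) * (1 / (1 + X * v) * (1 / (2 * pi)) *
            norm (\<integral>w. D w * of_real (Y * v) powr Complex \<tau> w \<partial>lborel)) \<le> exp (- v) * (N * v powr \<tau>)"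
          by (intro mult_left_mono) auto
        moreover have "norm (F v) = exp (- v) * (1 / (1 + X * v) * (1 / (2 * pi)) *
            norm (\<integral>w. D w * of_real (Y * v) powr Complex \<tau> w \<partial>lborel))"
          using True XY by (simp add: F_def norm_mult norm_divide del: of_real_mult of_real_add)
        ultimately show ?thesis using True by (simp add: mult_ac)
      qed (simp add: F_def)
      then show "AE v in lborel. norm (F v) \<le>
          norm (N * (indicator {0<..} v *\<^sub>R (exp (- v) * v powr ((1 + \<tau>) - 1))))"
        by (intro AE_I2) (rule order.trans, assumption, simp only: real_norm_def abs_ge_self)
    qed simp
    then show "integrable lborel
      (\<lambda>v. indicator {0<..} v *\<^sub>R (of_real (exp (- v) / (1 + X * v)) *
        (1 / (2 * pi) * (\<integral>w. capacity_kernel r \<xi> \<alpha> n (Complex \<tau> w) *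
          of_real (Y * v) powr Complex \<tau> w \<partial>lborel))))"
      unfolding F_def[abs_def] D_def .
    define J where "J = (\<integral>u. (\<integral>w. Gamma (1 + Complex \<sigma> u + Complex \<tau> w) * A u * D w *
      of_real X powr Complex \<sigma> u * of_real Y powr Complex \<tau> w \<partial>lborel) \<partial>lborel)"
    \<comment> \<open>Each line contributes one factor \<i> through its parametrisation; together
      they cancel the square of \<i> in the normalisation.\<close>
    have "capacity_H r \<xi> \<alpha> n X Y = 1 / (2 * of_real pi * \<i>)\<^sup>2 * (J * \<i> * \<i>)"
      unfolding H vline_integral_def capacity_kernel_def[symmetric] J_def A_def D_def
      by (simp add: mult_ac)
    also have "\<dots> = 1 / (2 * pi)\<^sup>2 * J"
      by (simp add: power2_eq_square field_simps)
    also have "J = (\<integral>v. indicator {0<..} v *\<^sub>R (of_real (exp (- v)) *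
        (\<integral>u. A u * of_real (X * v) powr Complex \<sigma> u \<partial>lborel) *
        (\<integral>w. D w * of_real (Y * v) powr Complex \<tau> w \<partial>lborel)) \<partial>lborel)"
      unfolding J_def using \<sigma>\<tau> by (intro laplace_inverse_Mellin_product[symmetric] A D XY) simp
    also have "1 / (2 * pi)\<^sup>2 * \<dots> = (\<integral>v. 1 / (2 * pi)\<^sup>2 * (indicator {0<..} v *\<^sub>R (of_real (exp (- v)) *
        (\<integral>u. A u * of_real (X * v) powr Complex \<sigma> u \<partial>lborel) *
        (\<integral>w. D w * of_real (Y * v) powr Complex \<tau> w \<partial>lborel))) \<partial>lborel)"
      by (rule integral_mult_right_zero[symmetric])
    also have "\<dots> = (\<integral>v. indicator {0<..} v *\<^sub>R (of_real (exp (- v) / (1 + X * v)) *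
        (1 / (2 * pi) * (\<integral>w. D w * of_real (Y * v) powr Complex \<tau> w \<partial>lborel))) \<partial>lborel)"
    proof (rule Bochner_Integration.integral_cong[OF refl])
      fix v :: real
      show "1 / (2 * pi)\<^sup>2 * (indicator {0<..} v *\<^sub>R (of_real (exp (- v)) *
          (\<integral>u. A u * of_real (X * v) powr Complex \<sigma> u \<partial>lborel) *
          (\<integral>w. D w * of_real (Y * v) powr Complex \<tau> w \<partial>lborel))) =
        indicator {0<..} v *\<^sub>R (of_real (exp (- v) / (1 + X * v)) *
          (1 / (2 * pi) * (\<integral>w. D w * of_real (Y * v) powr Complex \<tau> w \<partial>lborel)))"
      proof (cases "0 < v")
        case True
        then have "(\<integral>u. A u * of_real (X * v) powr Complex \<sigma> u \<partial>lborel) = of_real (2 * pi / (1 + X * v))"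
          unfolding A_def using inverse_Mellin_geometric(2)[OF \<sigma>\<tau>(1,2), of "X * v"] XY by simp
        then show ?thesis using True by (simp add: power2_eq_square)
      qed simp
    qed
    finally show "capacity_H r \<xi> \<alpha> n X Y =
      (\<integral>v. indicator {0<..} v *\<^sub>R (of_real (exp (- v) / (1 + X * v)) *
        (1 / (2 * pi) * (\<integral>w. capacity_kernel r \<xi> \<alpha> n (Complex \<tau> w) *
          of_real (Y * v) powr Complex \<tau> w \<partial>lborel))) \<partial>lborel)"
      unfolding D_def .
  qed
qed

text \<open>The interface to the probabilistic part: complex contours are gone, and the H-function
  is a real double integral against the summand of the density with index \<open>n\<close>.\<close>

lemma capacity_H_eq_real_integral:
  fixes \<xi> \<alpha> B \<mu> q X :: real
  assumes r: "r = 1 \<or> r = 2"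
    and pos: "0 < \<xi>" "0 < \<alpha>" "0 < n" "0 < B" "0 < \<mu>" "0 < q" "0 < X"
  defines "G \<equiv> \<lambda>y. Re (meijer_G 3 0 [of_real (\<xi>\<^sup>2 + 1)] [of_real (\<xi>\<^sup>2), of_real \<alpha>, of_nat n]
      (B * (y / \<mu>) powr (1 / real r)))"
  shows "\<And>p. 0 < p \<Longrightarrow> integrable lborel (\<lambda>y. indicator {0<..} y *\<^sub>R (exp (- (p / y)) / y * G y))"
    and "integrable lborel (\<lambda>v. indicator {0<..} v *\<^sub>R (exp (- v) / (1 + X * v) *
        (\<integral>y. indicator {0<..} y *\<^sub>R (exp (- (q * v / y)) / y * G y) \<partial>lborel)))"
    and "of_real (real r powr (\<alpha> + real n - 1) / (2 * pi) ^ (r - 1)) *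
        capacity_H r \<xi> \<alpha> n X (q * (B / (real r)\<^sup>2) ^ r / \<mu>) =
      of_real (\<integral>v. indicator {0<..} v *\<^sub>R (exp (- v) / (1 + X * v) *
        (\<integral>y. indicator {0<..} y *\<^sub>R (exp (- (q * v / y)) / y * G y) \<partial>lborel)) \<partial>lborel)"
proof -
  have r0: "0 < real r" using r by auto
  define GC where "GC y = meijer_G 3 0 [of_real (\<xi>\<^sup>2 + 1)] [of_real (\<xi>\<^sup>2), of_real \<alpha>, of_nat n]
      (B * (y / \<mu>) powr (1 / real r))" for y
  have G: "GC y = of_real (G y)" if "0 < y" for y
    using meijer_G_in_Reals[of "\<xi>\<^sup>2" \<alpha> "real n" "B * (y / \<mu>) powr (1 / real r)"] pos that r0
    by (simp add: GC_def G_def)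
  have ind: "indicator {0<..} y *\<^sub>R (of_real (exp (- (p / y)) / y) * GC y) =
      complex_of_real (indicator {0<..} y *\<^sub>R (exp (- (p / y)) / y * G y))" for p y
    by (cases "0 < y") (simp_all add: G)
  show "integrable lborel (\<lambda>y. indicator {0<..} y *\<^sub>R (exp (- (p / y)) / y * G y))" if "0 < p" for p
  proof -
    \<comment> \<open>The value \<open>- 1\<close> is an arbitrary negative choice of
      \<open>\<tau>\<close>; the integrability statement does not mention the line.\<close>
    have "integrable lborel (\<lambda>y. complex_of_real (indicator {0<..} y *\<^sub>R (exp (- (p / y)) / y * G y)))"
      using inverse_exp_moment_capacity_kernel(1)[OF r pos(1-5) that, of "- 1"]
      unfolding ind[symmetric] GC_def by simp
    from integrable_Re[OF this] show ?thesis by simp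
  qed
  obtain \<tau> where \<tau>: "\<tau> < 0"
    and H_int: "\<And>X Y. 0 < X \<Longrightarrow> 0 < Y \<Longrightarrow> integrable lborel
      (\<lambda>v. indicator {0<..} v *\<^sub>R (of_real (exp (- v) / (1 + X * v)) *
        (1 / (2 * pi) * (\<integral>w. capacity_kernel r \<xi> \<alpha> n (Complex \<tau> w) *
          of_real (Y * v) powr Complex \<tau> w \<partial>lborel))))"
    and H: "\<And>X Y. 0 < X \<Longrightarrow> 0 < Y \<Longrightarrow> capacity_H r \<xi> \<alpha> n X Y =
      (\<integral>v. indicator {0<..} v *\<^sub>R (of_real (exp (- v) / (1 + X * v)) *
        (1 / (2 * pi) * (\<integral>w. capacity_kernel r \<xi> \<alpha> n (Complex \<tau> w) *
          of_real (Y * v) powr Complex \<tau> w \<partial>lborel))) \<partial>lborel)"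
    using capacity_H_eq_laplace_integral[OF r pos(1-3)] by blast
  define K where "K = real r powr (\<alpha> + real n - 1) / (2 * pi) ^ (r - 1)"
  define Y where "Y = q * (B / (real r)\<^sup>2) ^ r / \<mu>"
  have Y: "0 < Y" using pos r0 by (simp add: Y_def)
  define L where "L v = (\<integral>y. indicator {0<..} y *\<^sub>R (exp (- (q * v / y)) / y * G y) \<partial>lborel)" for v
  have L: "of_real (L v) = of_real K * (1 / (2 * pi) * (\<integral>w. capacity_kernel r \<xi> \<alpha> n (Complex \<tau> w) *
          of_real (Y * v) powr Complex \<tau> w \<partial>lborel))" if "0 < v" for v
  proof -
    have "of_real (L v) = (\<integral>y. indicator {0<..} y *\<^sub>R (of_real (exp (- (q * v / y)) / y) * GC y) \<partial>lborel)"
      unfolding L_def ind by (rule integral_complex_of_real[symmetric])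
    also have "\<dots> = of_real K / (2 * pi) * (\<integral>w. capacity_kernel r \<xi> \<alpha> n (Complex \<tau> w) *
        of_real (q * v * (B / (real r)\<^sup>2) ^ r / \<mu>) powr Complex \<tau> w \<partial>lborel)"
      unfolding GC_def K_def using pos that \<tau>
      by (intro inverse_exp_moment_capacity_kernel(2) r) auto
    also have "q * v * (B / (real r)\<^sup>2) ^ r / \<mu> = Y * v"
      by (simp add: Y_def)
    finally show ?thesis by simp
  qed
  have H_L: "of_real K * (indicator {0<..} v *\<^sub>R (of_real (exp (- v) / (1 + X * v)) *
        (1 / (2 * pi) * (\<integral>w. capacity_kernel r \<xi> \<alpha> n (Complex \<tau> w) *
          of_real (Y * v) powr Complex \<tau> w \<partial>lborel)))) =
      of_real (indicator {0<..} v *\<^sub>R (exp (- v) / (1 + X * v) * L v))" for v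
  proof (cases "0 < v")
    case True
    then have "of_real (indicator {0<..} v *\<^sub>R (exp (- v) / (1 + X * v) * L v)) =
        of_real (exp (- v) / (1 + X * v)) * complex_of_real (L v)"
      by simp
    then show ?thesis
      unfolding L[OF True] using True by (simp add: mult_ac)
  qed simp
  show "integrable lborel (\<lambda>v. indicator {0<..} v *\<^sub>R (exp (- v) / (1 + X * v) *
        (\<integral>y. indicator {0<..} y *\<^sub>R (exp (- (q * v / y)) / y * G y) \<partial>lborel)))"
    using integrable_Re[OF integrable_mult_right[OF H_int[OF pos(7) Y], of "of_real K"]]
    unfolding H_L L_def[symmetric] by simp
  have "of_real K * capacity_H r \<xi> \<alpha> n X Y =
      (\<integral>v. of_real K * (indicator {0<..} v *\<^sub>R (of_real (exp (- v) / (1 + X * v)) *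
        (1 / (2 * pi) * (\<integral>w. capacity_kernel r \<xi> \<alpha> n (Complex \<tau> w) *
          of_real (Y * v) powr Complex \<tau> w \<partial>lborel)))) \<partial>lborel)"
    unfolding H[OF pos(7) Y] by (rule integral_mult_right_zero[symmetric])
  also have "\<dots> = (\<integral>v. of_real (indicator {0<..} v *\<^sub>R (exp (- v) / (1 + X * v) * L v)) \<partial>lborel)"
    unfolding H_L ..
  also have "\<dots> = of_real (\<integral>v. indicator {0<..} v *\<^sub>R (exp (- v) / (1 + X * v) * L v) \<partial>lborel)"
    by (rule integral_complex_of_real)
  finally show "of_real (real r powr (\<alpha> + real n - 1) / (2 * pi) ^ (r - 1)) *
        capacity_H r \<xi> \<alpha> n X (q * (B / (real r)\<^sup>2) ^ r / \<mu>) =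
      of_real (\<integral>v. indicator {0<..} v *\<^sub>R (exp (- v) / (1 + X * v) *
        (\<integral>y. indicator {0<..} y *\<^sub>R (exp (- (q * v / y)) / y * G y) \<partial>lborel)) \<partial>lborel)"
    unfolding K_def Y_def L_def .
qed

subsection \<open>Ergodic capacity\<close>

lemma exponential_moments_integrable:
  fixes \<nu> :: real
  assumes \<nu>: "0 < \<nu>"
  shows "integrable lborel (\<lambda>x. indicator {0<..} x *\<^sub>R exp (- (\<nu> * x)))"
    and "integrable lborel (\<lambda>x. indicator {0<..} x *\<^sub>R (x * exp (- (\<nu> * x))))"
proof -
  have ind: "indicator {0<..} (\<nu> * x) = (indicator {0<..} x :: real)" for x
    using \<nu> by (simp add: indicator_def zero_less_mult_iff)
  have gam: "integrable lborel (\<lambda>x. indicator {0<..} (\<nu> * x) *\<^sub>R (exp (- (\<nu> * x)) * (\<nu> * x) powr (a - 1)))"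
    if "0 < a" for a :: real
    using lborel_integrable_real_affine[OF integrable.intros[OF has_bochner_integral_Gamma_real[OF that]], of \<nu> 0] \<nu>
    by simp
  have "(\<lambda>x. indicator {0<..} (\<nu> * x) *\<^sub>R (exp (- (\<nu> * x)) * (\<nu> * x) powr (1 - 1))) =
      (\<lambda>x. indicator {0<..} x *\<^sub>R exp (- (\<nu> * x)))"
    using \<nu> by (auto simp: fun_eq_iff indicator_def zero_less_mult_iff)
  then show "integrable lborel (\<lambda>x. indicator {0<..} x *\<^sub>R exp (- (\<nu> * x)))"
    using gam[of 1] by simp
  have "(\<lambda>x. 1 / \<nu> * (indicator {0<..} (\<nu> * x) *\<^sub>R (exp (- (\<nu> * x)) * (\<nu> * x) powr (2 - 1)))) =
      (\<lambda>x. indicator {0<..} x *\<^sub>R (x * exp (- (\<nu> * x))))"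
    using \<nu> by (auto simp: fun_eq_iff indicator_def zero_less_mult_iff)
  then show "integrable lborel (\<lambda>x. indicator {0<..} x *\<^sub>R (x * exp (- (\<nu> * x))))"
    using integrable_mult_right[OF gam[of 2], of "1 / \<nu>"] by simp
qed

text \<open>Integration by parts, followed by \<open>x = s * v\<close>. The scale \<open>s\<close>
  stays free so that it can later depend on the SNR of the second hop.\<close>

lemma ln_exponential_integral:
  fixes a \<nu> s :: real
  assumes a: "0 < a" and \<nu>: "0 < \<nu>" and s: "0 < s"
  shows "integrable lborel (\<lambda>x. indicator {0<..} x *\<^sub>R (ln (1 + a * x) * exp (- (\<nu> * x))))"
    and "\<nu> * (\<integral>x. indicator {0<..} x *\<^sub>R (ln (1 + a * x) * exp (- (\<nu> * x))) \<partial>lborel) =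
      a * s * (\<integral>v. indicator {0<..} v *\<^sub>R (exp (- (\<nu> * s * v)) / (1 + a * s * v)) \<partial>lborel)"
proof -
  define f where "f x = ln (1 + a * x) * exp (- (\<nu> * x))" for x
  define g where "g x = exp (- (\<nu> * x)) / (1 + a * x)" for x
  have f: "integrable lborel (\<lambda>x. indicator {0<..} x *\<^sub>R f x)"
  proof (rule Bochner_Integration.integrable_bound)
    show "integrable lborel (\<lambda>x. a * (indicator {0<..} x *\<^sub>R (x * exp (- (\<nu> * x)))))"
      by (intro integrable_mult_right exponential_moments_integrable \<nu>)
    have "norm (indicator {0<..} x *\<^sub>R f x) \<le> norm (a * (indicator {0<..} x *\<^sub>R (x * exp (- (\<nu> * x)))))" for x
    proof (cases "0 < x")
      case True
      then have "0 < a * x" using a by simp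
      then have "0 \<le> ln (1 + a * x)" "ln (1 + a * x) \<le> a * x"
        by (auto intro: ln_add_one_self_le_self)
      then show ?thesis using True a by (simp add: f_def abs_mult)
    qed simp
    then show "AE x in lborel. norm (indicator {0<..} x *\<^sub>R f x) \<le>
        norm (a * (indicator {0<..} x *\<^sub>R (x * exp (- (\<nu> * x)))))" by simp
  qed (simp add: f_def)
  then show "integrable lborel (\<lambda>x. indicator {0<..} x *\<^sub>R (ln (1 + a * x) * exp (- (\<nu> * x))))"
    by (simp add: f_def)
  have g: "integrable lborel (\<lambda>x. indicator {0<..} x *\<^sub>R g x)"
  proof (rule Bochner_Integration.integrable_bound)
    show "integrable lborel (\<lambda>x. indicator {0<..} x *\<^sub>R exp (- (\<nu> * x)))"
      by (intro exponential_moments_integrable \<nu>)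
    have "norm (indicator {0<..} x *\<^sub>R g x) \<le> norm (indicator {0<..} x *\<^sub>R exp (- (\<nu> * x)))" for x
    proof (cases "0 < x")
      case True
      then have "0 < a * x" using a by simp
      then show ?thesis using True by (simp add: g_def divide_le_eq)
    qed simp
    then show "AE x in lborel. norm (indicator {0<..} x *\<^sub>R g x) \<le>
        norm (indicator {0<..} x *\<^sub>R exp (- (\<nu> * x)))" by simp
  qed (simp add: g_def)
  \<comment> \<open>An antiderivative of \<open>\<nu> * f x - a * g x\<close> that vanishes at 0,
    because of the logarithm, and at infinity, because of the exponential. No boundary term
    survives.\<close>
  define F where "F x = - (ln (1 + a * x) * exp (- (\<nu> * x)))" for x
  have "(LBINT x=0..\<infinity>. \<nu> * f x - a * g x) = 0 - 0"
  proof (rule interval_integral_FTC_integrable[where F = F])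
    fix x :: real
    assume "0 < ereal x"
    then have x: "0 < 1 + a * x" using a by (simp add: add_pos_nonneg)
    show "(F has_vector_derivative \<nu> * f x - a * g x) (at x)"
      unfolding has_real_derivative_iff_has_vector_derivative[symmetric] F_def f_def g_def
      using x by (auto intro!: derivative_eq_intros simp: field_simps)
    show "isCont (\<lambda>x. \<nu> * f x - a * g x) x"
      unfolding f_def g_def using x by (intro continuous_intros) auto
  next
    have "set_integrable lborel {0<..} (\<lambda>x. \<nu> * f x - a * g x)"
      using f g by (intro set_integral_diff set_integrable_mult_right) (simp_all add: set_integrable_def)
    then show "set_integrable lborel (einterval 0 \<infinity>) (\<lambda>x. \<nu> * f x - a * g x)"
      by (simp add: einterval_def greaterThan_def)
    have "(F \<longlongrightarrow> F 0) (at_right 0)"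
      unfolding F_def using a by (intro tendsto_intros) auto
    then show "((F \<circ> real_of_ereal) \<longlongrightarrow> 0) (at_right 0)"
      unfolding zero_ereal_def ereal_tendsto_simps by (simp add: F_def)
    have "(F \<longlongrightarrow> 0) at_top"
      unfolding F_def using a \<nu> by real_asymp
    then show "((F \<circ> real_of_ereal) \<longlongrightarrow> 0) (at_left \<infinity>)"
      unfolding ereal_tendsto_simps .
  qed simp
  then have "(\<integral>x. indicator {0<..} x *\<^sub>R (\<nu> * f x - a * g x) \<partial>lborel) = 0"
    by (simp add: interval_lebesgue_integral_0_infty set_lebesgue_integral_def)
  moreover have "(\<integral>x. indicator {0<..} x *\<^sub>R (\<nu> * f x - a * g x) \<partial>lborel) =
      (\<integral>x. \<nu> * (indicator {0<..} x *\<^sub>R f x) - a * (indicator {0<..} x *\<^sub>R g x) \<partial>lborel)"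
    by (simp add: algebra_simps)
  moreover have "\<dots> = \<nu> * (\<integral>x. indicator {0<..} x *\<^sub>R f x \<partial>lborel) - a * (\<integral>x. indicator {0<..} x *\<^sub>R g x \<partial>lborel)"
    by (simp only: Bochner_Integration.integral_diff[OF integrable_mult_right[OF f] integrable_mult_right[OF g]]
        integral_mult_right_zero)
  ultimately have "\<nu> * (\<integral>x. indicator {0<..} x *\<^sub>R f x \<partial>lborel) = a * (\<integral>x. indicator {0<..} x *\<^sub>R g x \<partial>lborel)"
    by simp
  also have "(\<integral>x. indicator {0<..} x *\<^sub>R g x \<partial>lborel) = s * (\<integral>v. indicator {0<..} (s * v) *\<^sub>R g (s * v) \<partial>lborel)"
    using lborel_integral_real_affine[of s "\<lambda>x. indicator {0<..} x *\<^sub>R g x" 0] s by simp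
  also have "(\<lambda>v. indicator {0<..} (s * v) *\<^sub>R g (s * v)) =
      (\<lambda>v. indicator {0<..} v *\<^sub>R (exp (- (\<nu> * s * v)) / (1 + a * s * v)))"
    using s by (auto simp: g_def indicator_def zero_less_mult_iff mult_ac)
  finally show "\<nu> * (\<integral>x. indicator {0<..} x *\<^sub>R (ln (1 + a * x) * exp (- (\<nu> * x))) \<partial>lborel) =
      a * s * (\<integral>v. indicator {0<..} v *\<^sub>R (exp (- (\<nu> * s * v)) / (1 + a * s * v)) \<partial>lborel)"
    by (simp add: f_def mult.assoc)
qed

text \<open>The joint density is the product of the two. The first variable is integrated innermost,
  which amounts to conditioning on the second.\<close>

lemma (in prob_space) indep_var_pair_expectation:
  fixes X Y :: "'a \<Rightarrow> real"
  assumes X: "has_pdf M X f" and Y: "has_pdf M Y g" and ind: "indep_var borel X borel Y"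
    and h[measurable]: "case_prod h \<in> borel_measurable (lborel \<Otimes>\<^sub>M lborel)"
    and int: "integrable M (\<lambda>\<omega>. h (X \<omega>) (Y \<omega>))"
  shows "expectation (\<lambda>\<omega>. h (X \<omega>) (Y \<omega>)) = (\<integral>y. (\<integral>x. f x * g y * h x y \<partial>lborel) \<partial>lborel)"
proof -
  have nn: "0 \<le> f x" "0 \<le> g y" for x y
    using X Y by (auto simp: has_pdf_def)
  have "indep_var lborel X lborel Y"
    using ind by (simp add: indep_var_eq)
  then have "distributed M (lborel \<Otimes>\<^sub>M lborel) (\<lambda>\<omega>. (X \<omega>, Y \<omega>)) (\<lambda>(x, y). ennreal (f x) * ennreal (g y))"
    using X Y unfolding has_pdf_def
    by (intro distributed_joint_indep) (auto intro: lborel.sigma_finite_measure_axioms)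
  also have "(\<lambda>(x, y). ennreal (f x) * ennreal (g y)) = (\<lambda>p. ennreal (case p of (x, y) \<Rightarrow> f x * g y))"
    using nn by (auto simp: ennreal_mult)
  finally have D: "distributed M (lborel \<Otimes>\<^sub>M lborel) (\<lambda>\<omega>. (X \<omega>, Y \<omega>))
      (\<lambda>p. ennreal (case p of (x, y) \<Rightarrow> f x * g y))" .
  have nn': "0 \<le> (case p of (x, y) \<Rightarrow> f x * g y)" for p
    using nn by (auto split: prod.split)
  have eq: "(\<lambda>p. (case p of (x, y) \<Rightarrow> f x * g y) * case_prod h p) = (\<lambda>(x, y). f x * g y * h x y)"
    by auto
  have "integrable (lborel \<Otimes>\<^sub>M lborel) (\<lambda>(x, y). f x * g y * h x y)"
    using distributed_integrable[OF D h nn'] int unfolding eq by simp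
  then have "(\<integral>y. (\<integral>x. f x * g y * h x y \<partial>lborel) \<partial>lborel) =
      (\<integral>p. (case p of (x, y) \<Rightarrow> f x * g y * h x y) \<partial>(lborel \<Otimes>\<^sub>M lborel))"
    by (rule lborel_pair.integral_snd)
  also have "\<dots> = expectation (\<lambda>\<omega>. h (X \<omega>) (Y \<omega>))"
    using distributed_integral[OF D h nn'] unfolding eq by simp
  finally show ?thesis ..
qed

theorem mainTheorem5:
  fixes P :: "'a measure" and \<gamma>\<^sub>1 \<gamma>\<^sub>2 \<gamma> :: "'a \<Rightarrow> real"
    and M m r \<beta> :: nat
    and \<rho> \<mu>\<^sub>1 \<mu>\<^sub>r \<xi> \<alpha> g \<Omega>' B \<kappa> C varpi :: real
    and \<zeta>\<^sub>3 \<zeta>\<^sub>4 :: "nat \<Rightarrow> real"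
  assumes "prob_space P"
    and "1 \<le> M" and "1 \<le> m" and "m \<le> M"
    and "0 \<le> \<rho>" and "\<rho> \<le> 1" and "0 < \<mu>\<^sub>1"
    and "r = 1 \<or> r = 2" and "0 < \<mu>\<^sub>r" and "0 < \<xi>"
    and "0 < \<alpha>" and "1 \<le> \<beta>" and "0 < g" and "0 < \<Omega>'" and "0 < B"
    and "1 \<le> \<kappa>"
    and "\<forall>\<omega>\<in>space P. 0 \<le> \<gamma>\<^sub>1 \<omega>" and "has_pdf P \<gamma>\<^sub>1 (rf_pdf M m \<rho> \<mu>\<^sub>1)"
    and "\<forall>\<omega>\<in>space P. 0 < \<gamma>\<^sub>2 \<omega>" and "has_pdf P \<gamma>\<^sub>2 (malaga_pdf r \<mu>\<^sub>r \<xi> \<alpha> \<beta> g \<Omega>' B)"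
    and "prob_space.indep_var P borel \<gamma>\<^sub>1 borel \<gamma>\<^sub>2"
    and "C = prob_space.expectation P \<gamma>\<^sub>1 + \<kappa>"
    and "\<And>\<omega>. \<gamma> \<omega> = \<gamma>\<^sub>1 \<omega> * \<gamma>\<^sub>2 \<omega> / (\<kappa> * \<gamma>\<^sub>2 \<omega> + C)"
    and "varpi = (if r = 1 then 1 else exp 1 / (2 * pi))"
    and "\<And>k. \<zeta>\<^sub>3 k = real (M - m + k + 1) * \<kappa> / (real (M - m + k) * (1 - \<rho>) + 1)"
    and "\<And>k. \<zeta>\<^sub>4 k = real (M - m + k + 1) * C / (real (M - m + k) * (1 - \<rho>) + 1)
                    * (B / (real r)\<^sup>2) ^ r"
  shows "integrable P (\<lambda>\<omega>. log 2 (1 + varpi * \<gamma> \<omega>)) \<and>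
    complex_of_real (prob_space.expectation P (\<lambda>\<omega>. log 2 (1 + varpi * \<gamma> \<omega>))) =
      of_real (real m * \<xi>\<^sup>2 * malaga_A \<alpha> \<beta> g \<Omega>' * varpi * \<mu>\<^sub>1 /
               (2 ^ r * (2 * pi) ^ (r - 1) * ln 2) * real (M choose m)) *
      (\<Sum>k = 0..m - 1. \<Sum>n = 1..\<beta>.
        of_real (real ((m - 1) choose k) *
          ((- 1) ^ k * malaga_b \<alpha> \<beta> g \<Omega>' n * real r powr (\<alpha> + real n - 1) /
           (real (M - m + k + 1) * \<zeta>\<^sub>3 k))) *
        capacity_H r \<xi> \<alpha> n (varpi * \<mu>\<^sub>1 / \<zeta>\<^sub>3 k) (\<zeta>\<^sub>4 k / (\<zeta>\<^sub>3 k * \<mu>\<^sub>r)))"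
proof -
  interpret prob_space P by fact
  note r = \<open>r = 1 \<or> r = 2\<close>
  have pos: "0 < \<mu>\<^sub>1" "0 < \<mu>\<^sub>r" "0 < \<xi>" "0 < \<alpha>" "0 < B" "0 < \<kappa>"
    using assms by auto
  have varpi: "0 < varpi" by (simp add: assms)
  note pdf1 = \<open>has_pdf P \<gamma>\<^sub>1 (rf_pdf M m \<rho> \<mu>\<^sub>1)\<close>
    and pdf2 = \<open>has_pdf P \<gamma>\<^sub>2 (malaga_pdf r \<mu>\<^sub>r \<xi> \<alpha> \<beta> g \<Omega>' B)\<close>
  define f1 where "f1 = rf_pdf M m \<rho> \<mu>\<^sub>1"
  define f2 where "f2 = malaga_pdf r \<mu>\<^sub>r \<xi> \<alpha> \<beta> g \<Omega>' B"
  have d1: "distributed P lborel \<gamma>\<^sub>1 (\<lambda>x. ennreal (f1 x))" and f1_nn: "0 \<le> f1 x" for x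
    using pdf1 by (auto simp: has_pdf_def f1_def)
  have d2: "distributed P lborel \<gamma>\<^sub>2 (\<lambda>x. ennreal (f2 x))" and f2_nn: "0 \<le> f2 x" for x
    using pdf2 by (auto simp: has_pdf_def f2_def)
  have [measurable]: "\<gamma>\<^sub>1 \<in> borel_measurable P" "\<gamma>\<^sub>2 \<in> borel_measurable P"
    using distributed_measurable[OF d1] distributed_measurable[OF d2] by simp_all
  \<comment> \<open>The constant 1 is integrable on a probability space; transported to the density,
    this gives integrability without any estimate of the G-function.\<close>
  have f2_int: "integrable lborel f2"
    using distributed_integrable[OF d2, of "\<lambda>_. 1"] f2_nn by simp
  have [measurable]: "f2 \<in> borel_measurable borel"
    using borel_measurable_integrable[OF f2_int] by simp

  \<comment> \<open>The first hop as a signed mixture of exponentials\<close>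
  define D where "D k = real (M - m + k) * (1 - \<rho>) + 1" for k
  have D: "0 < D k" for k
    using assms by (simp add: D_def add_nonneg_pos)
  define rate where "rate k = real (M - m + k + 1) / (D k * \<mu>\<^sub>1)" for k
  have rate: "0 < rate k" for k
    using D[of k] pos by (simp add: rate_def)
  define c where "c k = real m * real (M choose m) * ((- 1) ^ k * real ((m - 1) choose k) / (D k * \<mu>\<^sub>1))" for k
  have f1: "f1 x = (\<Sum>k = 0..m - 1. c k * exp (- (rate k * x)))" if "0 \<le> x" for x
    using that by (simp add: f1_def rf_pdf_def c_def rate_def D_def sum_distrib_left mult_ac)
  have f1_neg: "f1 x = 0" if "x < 0" for x
    using that by (simp add: f1_def rf_pdf_def)

  have \<gamma>1_int: "integrable P \<gamma>\<^sub>1"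
  proof (rule distributed_integrable_var[OF d1 f1_nn])
    \<comment> \<open>The mixture formula holds on the closed half-line; the factor \<open>x\<close>
      removes the point 0, so the open indicator is correct.\<close>
    have "f1 x * x = (\<Sum>k = 0..m - 1. c k * (indicator {0<..} x *\<^sub>R (x * exp (- (rate k * x)))))" for x
    proof (cases "0 < x")
      case True
      then show ?thesis by (simp add: f1 sum_distrib_left sum_distrib_right mult_ac)
    next
      case False
      then show ?thesis by (cases "x = 0") (simp_all add: f1_neg)
    qed
    then show "integrable lborel (\<lambda>x. f1 x * x)"
      by (simp only:) (intro Bochner_Integration.integrable_sum integrable_mult_right
        exponential_moments_integrable(2) rate)
  qed
  have C: "0 < C"
  proof -
    have "0 \<le> expectation \<gamma>\<^sub>1"
      using assms(17) by (intro integral_nonneg_AE AE_I2) auto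
    then show ?thesis using pos by (simp add: assms(22))
  qed

  \<comment> \<open>Integrability of the capacity\<close>
  define h where "h x y = ln (1 + varpi * (x * y / (\<kappa> * y + C)))" for x y
  have h_meas: "case_prod h \<in> borel_measurable (lborel \<Otimes>\<^sub>M lborel)"
    unfolding h_def by measurable
  \<comment> \<open>Dropping \<open>C > 0\<close> from the denominator gives \<gamma> at most
    \<open>\<gamma>\<^sub>1 / \<kappa>\<close>, and \<open>ln (1 + z) \<le> z\<close> for the
    nonnegative \<open>z\<close>.\<close>
  have h_int: "integrable P (\<lambda>\<omega>. h (\<gamma>\<^sub>1 \<omega>) (\<gamma>\<^sub>2 \<omega>))"
  proof (rule Bochner_Integration.integrable_bound)
    show "integrable P (\<lambda>\<omega>. varpi / \<kappa> * \<gamma>\<^sub>1 \<omega>)"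
      using \<gamma>1_int by (rule integrable_mult_right)
    show "(\<lambda>\<omega>. h (\<gamma>\<^sub>1 \<omega>) (\<gamma>\<^sub>2 \<omega>)) \<in> borel_measurable P"
      unfolding h_def by measurable
    show "AE \<omega> in P. norm (h (\<gamma>\<^sub>1 \<omega>) (\<gamma>\<^sub>2 \<omega>)) \<le> norm (varpi / \<kappa> * \<gamma>\<^sub>1 \<omega>)"
    proof (rule AE_I2)
      fix \<omega> assume "\<omega> \<in> space P"
      then have x: "0 \<le> \<gamma>\<^sub>1 \<omega>" and y: "0 < \<gamma>\<^sub>2 \<omega>" using assms(17,19) by auto
      define z where "z = varpi * (\<gamma>\<^sub>1 \<omega> * \<gamma>\<^sub>2 \<omega> / (\<kappa> * \<gamma>\<^sub>2 \<omega> + C))"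
      have den: "0 < \<kappa> * \<gamma>\<^sub>2 \<omega> + C" using pos y C by (simp add: add_pos_pos)
      have "0 \<le> z" using x y den varpi by (simp add: z_def)
      moreover have "z \<le> varpi * (\<gamma>\<^sub>1 \<omega> / \<kappa>)"
        unfolding z_def using varpi x y den pos C
        by (intro mult_left_mono) (simp_all add: field_simps)
      ultimately have "0 \<le> ln (1 + z)" "ln (1 + z) \<le> varpi / \<kappa> * \<gamma>\<^sub>1 \<omega>"
        using ln_add_one_self_le_self[of z] by auto
      moreover have "h (\<gamma>\<^sub>1 \<omega>) (\<gamma>\<^sub>2 \<omega>) = ln (1 + z)"
        by (simp only: h_def z_def)
      ultimately show "norm (h (\<gamma>\<^sub>1 \<omega>) (\<gamma>\<^sub>2 \<omega>)) \<le> norm (varpi / \<kappa> * \<gamma>\<^sub>1 \<omega>)"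
        by (simp only: real_norm_def abs_of_nonneg)
    qed
  qed
  have log_h: "log 2 (1 + varpi * \<gamma> \<omega>) = h (\<gamma>\<^sub>1 \<omega>) (\<gamma>\<^sub>2 \<omega>) / ln 2" for \<omega>
    by (simp add: log_def h_def assms(23))

  define q where "q = C / \<kappa>"
  have q: "0 < q" using C pos by (simp add: q_def)
  define X where "X k = varpi * \<mu>\<^sub>1 / \<zeta>\<^sub>3 k" for k
  have \<zeta>\<^sub>3: "\<zeta>\<^sub>3 k = rate k * \<mu>\<^sub>1 * \<kappa>" for k
    using pos by (simp only: assms(25) rate_def D_def) simp
  have \<zeta>\<^sub>4: "\<zeta>\<^sub>4 k = rate k * \<mu>\<^sub>1 * C * (B / (real r)\<^sup>2) ^ r" for k
    using pos by (simp only: assms(26) rate_def D_def) simp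
  have X: "0 < X k" and rate_X: "rate k * X k = varpi / \<kappa>" for k
    using varpi pos rate[of k] by (simp_all add: X_def \<zeta>\<^sub>3)
  \<comment> \<open>The integrand once \<open>\<gamma>\<^sub>1\<close> has been averaged out:
    \<open>y\<close> occurs only in the density and in the exponent.\<close>
  define F where "F k y v = f2 y * (indicator {0<..} v *\<^sub>R (exp (- ((1 + q / y) * v)) / (1 + X k * v)))"
    for k and y v :: real

  have inner: "(\<integral>x. f1 x * f2 y * h x y \<partial>lborel) =
      (\<Sum>k = 0..m - 1. c k / rate k * X k * (\<integral>v. F k y v \<partial>lborel))" for y
  proof (cases "0 < y")
    case False
    then show ?thesis by (simp add: f2_def malaga_pdf_def F_def)
  next
    case y: True
    define a where "a = varpi * y / (\<kappa> * y + C)"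
    have den: "0 < \<kappa> * y + C" using pos y C by (simp add: add_pos_pos)
    have a: "0 < a" using varpi y den by (simp add: a_def)
    define E where "E k x = indicator {0<..} x *\<^sub>R (ln (1 + a * x) * exp (- (rate k * x)))" for k x
    have E_int: "integrable lborel (E k)" for k
      using ln_exponential_integral(1)[OF a rate[of k], of 1] by (simp add: E_def[abs_def])
    have E: "(\<integral>x. E k x \<partial>lborel) = X k / rate k *
        (\<integral>v. indicator {0<..} v *\<^sub>R (exp (- ((1 + q / y) * v)) / (1 + X k * v)) \<partial>lborel)" for k
    proof -
      \<comment> \<open>Chosen so that \<open>rate k * s = 1 + q / y\<close>. As
        \<open>\<kappa> * y + C = \<kappa> * y * (1 + q / y)\<close>, the product
        \<open>a * s\<close> becomes \<open>X k\<close>, free of \<open>y\<close>.\<close>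
      define s where "s = (1 + q / y) / rate k"
      have s: "0 < s" using q y rate[of k] by (simp add: s_def add_pos_pos)
      have rs: "rate k * s = 1 + q / y" using rate[of k] by (simp add: s_def)
      have "1 + q / y = (\<kappa> * y + C) / (\<kappa> * y)"
        using y pos by (simp add: q_def add_divide_distrib)
      then have ax: "a * (1 + q / y) = rate k * X k"
        unfolding rate_X
        using den y by (simp add: a_def)
      then have as: "a * s = X k"
        unfolding s_def times_divide_eq_right ax using rate[of k] by simp
      show ?thesis
        using ln_exponential_integral(2)[OF a rate[of k] s] rate[of k]
        unfolding E_def rs as by (simp add: field_simps)
    qed
    have "f1 x * f2 y * h x y = (\<Sum>k = 0..m - 1. f2 y * c k * E k x)" for x
    proof (cases "0 < x")
      case True
      have "h x y = ln (1 + a * x)" by (simp add: h_def a_def mult_ac)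
      then show ?thesis
        using True by (simp add: f1 E_def sum_distrib_left sum_distrib_right mult_ac)
    next
      case False
      then show ?thesis by (cases "x = 0") (simp_all add: f1_neg E_def h_def)
    qed
    then have "(\<integral>x. f1 x * f2 y * h x y \<partial>lborel) = (\<Sum>k = 0..m - 1. f2 y * c k * (\<integral>x. E k x \<partial>lborel))"
      using E_int by (simp add: Bochner_Integration.integral_sum)
    also have "\<dots> = (\<Sum>k = 0..m - 1. c k / rate k * X k * (\<integral>v. F k y v \<partial>lborel))"
      unfolding E F_def integral_mult_right_zero by (simp add: mult_ac)
    finally show ?thesis .
  qed

  \<comment> \<open>Averaging over the optical hop\<close>
  define lap where "lap n v = (\<integral>y. indicator {0<..} y *\<^sub>R (exp (- (q * v / y)) / y *
      Re (meijer_G 3 0 [of_real (\<xi>\<^sup>2 + 1)] [of_real (\<xi>\<^sup>2), of_real \<alpha>, of_nat n]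
        (B * (y / \<mu>\<^sub>r) powr (1 / real r)))) \<partial>lborel)" for n v
  define S where "S n k = (\<integral>v. indicator {0<..} v *\<^sub>R (exp (- v) / (1 + X k * v) * lap n v) \<partial>lborel)" for n k
  define b where "b n = \<xi>\<^sup>2 * malaga_A \<alpha> \<beta> g \<Omega>' / 2 ^ r * malaga_b \<alpha> \<beta> g \<Omega>' n" for n
  \<comment> \<open>Discarding \<open>q / y * v\<close> and \<open>X k * v\<close> separates the
    variables. The bound uses the nonnegativity of the whole density \<open>f2\<close>, before it is
    split over \<open>n\<close>.\<close>
  have F_le: "norm (F k y v) \<le> f2 y * (indicator {0<..} v *\<^sub>R exp (- (1 * v)))" for k y v
  proof (cases "0 < v \<and> 0 < y")
    case True
    then have "0 \<le> q / y * v" "0 < X k * v" using q X[of k] by auto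
    then have "exp (- ((1 + q / y) * v)) / (1 + X k * v) \<le> exp (- v) / 1"
      by (intro frac_le) (auto simp: algebra_simps)
    from mult_left_mono[OF this f2_nn[of y]] show ?thesis
      using True f2_nn[of y] \<open>0 < X k * v\<close> by (simp add: F_def abs_mult)
  qed (auto simp: F_def f2_def malaga_pdf_def)
  have F_meas: "case_prod (F k) \<in> borel_measurable (lborel \<Otimes>\<^sub>M lborel)" for k
    unfolding F_def by measurable
  note Fubini = Fubini_product_bound[OF F_meas f2_int exponential_moments_integrable(1)[OF zero_less_one] F_le]
  have outer: "(\<integral>y. F k y v \<partial>lborel) =
      (\<Sum>n = 1..\<beta>. b n * (indicator {0<..} v *\<^sub>R (exp (- v) / (1 + X k * v) * lap n v)))" for k v
  proof (cases "0 < v")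
    case True
    define Q where "Q n y = indicator {0<..} y *\<^sub>R (exp (- (q * v / y)) / y *
      Re (meijer_G 3 0 [of_real (\<xi>\<^sup>2 + 1)] [of_real (\<xi>\<^sup>2), of_real \<alpha>, of_nat n]
        (B * (y / \<mu>\<^sub>r) powr (1 / real r))))" for n y
    \<comment> \<open>Single summands are integrable against \<open>exp (- (p / y))\<close> for
      positive \<open>p\<close>; here \<open>p = q * v\<close>, hence the case distinction on
      \<open>v\<close>.\<close>
    have Q_int: "integrable lborel (Q n)" if "n \<in> {1..\<beta>}" for n
      unfolding Q_def using capacity_H_eq_real_integral(1)[OF r pos(3,4) _ pos(5,2) q X[of k], of n "q * v"] that True q
      by simp
    have "F k y v = (\<Sum>n = 1..\<beta>. exp (- v) / (1 + X k * v) * b n * Q n y)" for y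
    proof (cases "0 < y")
      case y: True
      have "exp (- ((1 + q / y) * v)) = exp (- v) * exp (- (q * v / y))"
        by (simp add: algebra_simps flip: exp_add)
      then show ?thesis
        using y True by (simp add: F_def f2_def malaga_pdf_def b_def Q_def sum_distrib_left sum_distrib_right mult_ac)
    qed (simp add: F_def f2_def malaga_pdf_def Q_def)
    then have "(\<integral>y. F k y v \<partial>lborel) = (\<Sum>n = 1..\<beta>. exp (- v) / (1 + X k * v) * b n * (\<integral>y. Q n y \<partial>lborel))"
      using Q_int by (simp add: Bochner_Integration.integral_sum)
    then show ?thesis
      using True by (simp add: lap_def Q_def mult_ac)
  qed (simp add: F_def)
  have S_int: "integrable lborel (\<lambda>v. indicator {0<..} v *\<^sub>R (exp (- v) / (1 + X k * v) * lap n v))"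
    if "n \<in> {1..\<beta>}" for n k
    unfolding lap_def using capacity_H_eq_real_integral(2)[OF r pos(3,4) _ pos(5,2) q X[of k], of n] that
    by simp
  have FS: "(\<integral>y. (\<integral>v. F k y v \<partial>lborel) \<partial>lborel) = (\<Sum>n = 1..\<beta>. b n * S n k)" for k
  proof -
    have "(\<integral>y. (\<integral>v. F k y v \<partial>lborel) \<partial>lborel) =
        (\<integral>v. (\<Sum>n = 1..\<beta>. b n * (indicator {0<..} v *\<^sub>R (exp (- v) / (1 + X k * v) * lap n v))) \<partial>lborel)"
      unfolding Fubini(2) outer ..
    also have "\<dots> = (\<Sum>n = 1..\<beta>. \<integral>v. b n * (indicator {0<..} v *\<^sub>R (exp (- v) / (1 + X k * v) * lap n v)) \<partial>lborel)"
      by (intro Bochner_Integration.integral_sum integrable_mult_right S_int)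
    finally show ?thesis unfolding integral_mult_right_zero S_def .
  qed
  have "expectation (\<lambda>\<omega>. h (\<gamma>\<^sub>1 \<omega>) (\<gamma>\<^sub>2 \<omega>)) = (\<integral>y. (\<integral>x. f1 x * f2 y * h x y \<partial>lborel) \<partial>lborel)"
    unfolding f1_def f2_def by (rule indep_var_pair_expectation[OF pdf1 pdf2 assms(21) h_meas h_int])
  also have "\<dots> = (\<Sum>k = 0..m - 1. \<integral>y. c k / rate k * X k * (\<integral>v. F k y v \<partial>lborel) \<partial>lborel)"
    unfolding inner by (intro Bochner_Integration.integral_sum integrable_mult_right Fubini(3))
  also have "\<dots> = (\<Sum>k = 0..m - 1. \<Sum>n = 1..\<beta>. c k / rate k * X k * b n * S n k)"
    unfolding integral_mult_right_zero FS by (simp add: sum_distrib_left mult_ac)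
  finally have E: "expectation (\<lambda>\<omega>. h (\<gamma>\<^sub>1 \<omega>) (\<gamma>\<^sub>2 \<omega>)) =
      (\<Sum>k = 0..m - 1. \<Sum>n = 1..\<beta>. c k / rate k * X k * b n * S n k)" .

  \<comment> \<open>Matching with the H-function and collecting constants\<close>
  define K where "K n = real r powr (\<alpha> + real n - 1) / (2 * pi) ^ (r - 1)" for n
  define H where "H n k = capacity_H r \<xi> \<alpha> n (varpi * \<mu>\<^sub>1 / \<zeta>\<^sub>3 k) (\<zeta>\<^sub>4 k / (\<zeta>\<^sub>3 k * \<mu>\<^sub>r))" for n k
  have S: "of_real (S n k) = of_real (K n) * H n k" if "n \<in> {1..\<beta>}" for n k
  proof -
    \<comment> \<open>\<open>\<zeta>\<^sub>3\<close> and \<open>\<zeta>\<^sub>4\<close> share the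
      factor \<open>rate k * \<mu>\<^sub>1\<close>, so the second argument of the H-function is the
      same for every \<open>k\<close>.\<close>
    have "\<zeta>\<^sub>4 k / (\<zeta>\<^sub>3 k * \<mu>\<^sub>r) = q * (B / (real r)\<^sup>2) ^ r / \<mu>\<^sub>r"
      using rate[of k] pos by (simp add: \<zeta>\<^sub>3 \<zeta>\<^sub>4 q_def)
    then have "H n k = capacity_H r \<xi> \<alpha> n (X k) (q * (B / (real r)\<^sup>2) ^ r / \<mu>\<^sub>r)"
      by (simp add: H_def X_def)
    then show ?thesis
      unfolding S_def lap_def K_def
      using capacity_H_eq_real_integral(3)[OF r pos(3,4) _ pos(5,2) q X[of k], of n] that by simp
  qed
  have coeff: "c k / rate k * X k * b n * K n / ln 2 =
      real m * \<xi>\<^sup>2 * malaga_A \<alpha> \<beta> g \<Omega>' * varpi * \<mu>\<^sub>1 / (2 ^ r * (2 * pi) ^ (r - 1) * ln 2) * real (M choose m) *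
      (real ((m - 1) choose k) * ((- 1) ^ k * malaga_b \<alpha> \<beta> g \<Omega>' n * real r powr (\<alpha> + real n - 1) /
           (real (M - m + k + 1) * \<zeta>\<^sub>3 k)))" for k n
  proof -
    \<comment> \<open>The normalisation \<open>D k * \<mu>\<^sub>1\<close> of the mixture weight
      cancels against the rate; the \<open>\<mu>\<^sub>1\<close> and \<open>\<zeta>\<^sub>3\<close>
      of the final coefficient come from \<open>X k\<close>.\<close>
    have "c k / rate k = real m * real (M choose m) * ((- 1) ^ k * real ((m - 1) choose k)) / real (M - m + k + 1)"
      using D[of k] pos by (simp add: c_def rate_def)
    then show ?thesis
      by (simp only:) (simp add: X_def b_def K_def mult_ac)
  qed
  show ?thesis
  proof
    show "integrable P (\<lambda>\<omega>. log 2 (1 + varpi * \<gamma> \<omega>))"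
      unfolding log_h using h_int by (intro integrable_divide_zero) auto
    have "expectation (\<lambda>\<omega>. log 2 (1 + varpi * \<gamma> \<omega>)) =
        (\<Sum>k = 0..m - 1. \<Sum>n = 1..\<beta>. c k / rate k * X k * b n * S n k) / ln 2"
      unfolding log_h integral_divide_zero E ..
    then have "complex_of_real (expectation (\<lambda>\<omega>. log 2 (1 + varpi * \<gamma> \<omega>))) =
        (\<Sum>k = 0..m - 1. \<Sum>n = 1..\<beta>. of_real (c k / rate k * X k * b n / ln 2) * of_real (S n k))"
      by (simp add: sum_divide_distrib)
    also have "\<dots> = (\<Sum>k = 0..m - 1. \<Sum>n = 1..\<beta>. of_real (c k / rate k * X k * b n * K n / ln 2) * H n k)"
      by (intro sum.cong refl) (simp add: S)
    finally show "complex_of_real (expectation (\<lambda>\<omega>. log 2 (1 + varpi * \<gamma> \<omega>))) =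
      of_real (real m * \<xi>\<^sup>2 * malaga_A \<alpha> \<beta> g \<Omega>' * varpi * \<mu>\<^sub>1 /
               (2 ^ r * (2 * pi) ^ (r - 1) * ln 2) * real (M choose m)) *
      (\<Sum>k = 0..m - 1. \<Sum>n = 1..\<beta>.
        of_real (real ((m - 1) choose k) *
          ((- 1) ^ k * malaga_b \<alpha> \<beta> g \<Omega>' n * real r powr (\<alpha> + real n - 1) /
           (real (M - m + k + 1) * \<zeta>\<^sub>3 k))) *
        capacity_H r \<xi> \<alpha> n (varpi * \<mu>\<^sub>1 / \<zeta>\<^sub>3 k) (\<zeta>\<^sub>4 k / (\<zeta>\<^sub>3 k * \<mu>\<^sub>r)))"
      unfolding coeff of_real_mult[of "_ * real (M choose m)"] H_def[symmetric]
      by (simp only: sum_distrib_left mult.assoc)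
  qed
qed

end
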